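(* If $\mathcal{E}$ is a locally cartesian closed model of guarded recursive terms, then so is every slice $\mathcal{E}/I$, with later functor $\blacktriangleright_I$ and transformation $\mathrm{next}$ on $\mathcal{E}/I$ as defined in the context.
   Context: A model of guarded recursive terms is a category $\mathcal{E}$ with finite products together with an endofunctor $\blacktriangleright:\mathcal{E}\to\mathcal{E}$ preserving finite limits and a natural transformation $\mathrm{next}:\mathrm{id}\to\blacktriangleright$ such that for every $f:\blacktriangleright X\to X$ there exists a unique $h:1\to X$ with $f\circ\mathrm{next}\circ h=h$. On $\mathcal{E}/I$, $\blacktriangleright_I$ is the composite $\mathcal{E}/I\to\mathcal{E}/\blacktriangleright I\to\mathcal{E}/I$ sending $p_X:X\to I$ first to $\blacktriangleright p_X:\blacktriangleright X\to\blacktriangleright I$ and then pulling back along $\mathrm{next}_I:I\to\blacktriangleright I$; the component of $\mathrm{next}$ at $p_Y$ is the map $Y\to\blacktriangleright_I Y$ into the pullback induced by $p_Y:Y\to I$ and $\mathrm{next}_Y:Y\to\blacktriangleright Y$. *)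

theory Defs
  imports Main
begin

section \<open>Categories, functors, natural transformations\<close>

text \<open>The fields are total on their types; only their behaviour on \<open>Ob\<close> and \<open>Arr\<close> (and on
  composable pairs of arrows, for composition) is meaningful.\<close>

record ('o, 'a) cat =
  Ob :: "'o set"
  Arr :: "'a set"
  Dom :: "'a \<Rightarrow> 'o"
  Cod :: "'a \<Rightarrow> 'o"
  Id :: "'o \<Rightarrow> 'a"
  Cmp :: "'a \<Rightarrow> 'a \<Rightarrow> 'a"  (infixr "\<cdot>\<index>" 75)

definition Hom :: "('o, 'a) cat \<Rightarrow> 'o \<Rightarrow> 'o \<Rightarrow> 'a set" where
  "Hom C X Y = {f \<in> Arr C. Dom C f = X \<and> Cod C f = Y}"

locale category =
  fixes C :: "('o, 'a) cat" (structure)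
  assumes Dom_in_Ob: "f \<in> Arr C \<Longrightarrow> Dom C f \<in> Ob C"
    and Cod_in_Ob: "f \<in> Arr C \<Longrightarrow> Cod C f \<in> Ob C"
    and Id_in_Hom: "X \<in> Ob C \<Longrightarrow> Id C X \<in> Hom C X X"
    and Cmp_in_Hom: "f \<in> Hom C X Y \<Longrightarrow> g \<in> Hom C Y Z \<Longrightarrow> g \<cdot> f \<in> Hom C X Z"
    and Cmp_Id_left: "f \<in> Hom C X Y \<Longrightarrow> Id C Y \<cdot> f = f"
    and Cmp_Id_right: "f \<in> Hom C X Y \<Longrightarrow> f \<cdot> Id C X = f"
    and Cmp_assoc: "f \<in> Hom C W X \<Longrightarrow> g \<in> Hom C X Y \<Longrightarrow> h \<in> Hom C Y Z \<Longrightarrow>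
                    (h \<cdot> g) \<cdot> f = h \<cdot> (g \<cdot> f)"

record ('o1, 'a1, 'o2, 'a2) func =
  on_ob :: "'o1 \<Rightarrow> 'o2"
  on_arr :: "'a1 \<Rightarrow> 'a2"

definition is_functor :: "('o1, 'a1) cat \<Rightarrow> ('o2, 'a2) cat \<Rightarrow> ('o1, 'a1, 'o2, 'a2) func \<Rightarrow> bool" where
  "is_functor C D F \<longleftrightarrow> category C \<and> category D \<and>
     (\<forall>X \<in> Ob C. on_ob F X \<in> Ob D) \<and>
     (\<forall>f \<in> Arr C. on_arr F f \<in> Hom D (on_ob F (Dom C f)) (on_ob F (Cod C f))) \<and>
     (\<forall>X \<in> Ob C. on_arr F (Id C X) = Id D (on_ob F X)) \<and>
     (\<forall>f \<in> Arr C. \<forall>g \<in> Arr C. Dom C g = Cod C f \<longrightarrow>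
        on_arr F (g \<cdot>\<^bsub>C\<^esub> f) = on_arr F g \<cdot>\<^bsub>D\<^esub> on_arr F f)"

definition id_func :: "('o, 'a, 'o, 'a) func" where
  "id_func = \<lparr>on_ob = (\<lambda>X. X), on_arr = (\<lambda>f. f)\<rparr>"

definition comp_func ::
  "('o2, 'a2, 'o3, 'a3) func \<Rightarrow> ('o1, 'a1, 'o2, 'a2) func \<Rightarrow> ('o1, 'a1, 'o3, 'a3) func" where
  "comp_func G F = \<lparr>on_ob = (\<lambda>X. on_ob G (on_ob F X)), on_arr = (\<lambda>f. on_arr G (on_arr F f))\<rparr>"

definition is_nat_trans :: "('o1, 'a1) cat \<Rightarrow> ('o2, 'a2) cat \<Rightarrow> ('o1, 'a1, 'o2, 'a2) func \<Rightarrow>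
    ('o1, 'a1, 'o2, 'a2) func \<Rightarrow> ('o1 \<Rightarrow> 'a2) \<Rightarrow> bool" where
  "is_nat_trans C D F G \<eta> \<longleftrightarrow> is_functor C D F \<and> is_functor C D G \<and>
     (\<forall>X \<in> Ob C. \<eta> X \<in> Hom D (on_ob F X) (on_ob G X)) \<and>
     (\<forall>f \<in> Arr C. on_arr G f \<cdot>\<^bsub>D\<^esub> \<eta> (Dom C f) = \<eta> (Cod C f) \<cdot>\<^bsub>D\<^esub> on_arr F f)"


section \<open>Limits\<close>

definition is_cone :: "('j, 'k) cat \<Rightarrow> ('o, 'a) cat \<Rightarrow> ('j, 'k, 'o, 'a) func \<Rightarrow>
    'o \<Rightarrow> ('j \<Rightarrow> 'a) \<Rightarrow> bool" where
  "is_cone J C D L \<pi> \<longleftrightarrow> L \<in> Ob C \<and>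
     (\<forall>j \<in> Ob J. \<pi> j \<in> Hom C L (on_ob D j)) \<and>
     (\<forall>u \<in> Arr J. on_arr D u \<cdot>\<^bsub>C\<^esub> \<pi> (Dom J u) = \<pi> (Cod J u))"

definition is_limit :: "('j, 'k) cat \<Rightarrow> ('o, 'a) cat \<Rightarrow> ('j, 'k, 'o, 'a) func \<Rightarrow>
    'o \<Rightarrow> ('j \<Rightarrow> 'a) \<Rightarrow> bool" where
  "is_limit J C D L \<pi> \<longleftrightarrow> is_cone J C D L \<pi> \<and>
     (\<forall>M \<mu>. is_cone J C D M \<mu> \<longrightarrow>
        (\<exists>!h. h \<in> Hom C M L \<and> (\<forall>j \<in> Ob J. \<pi> j \<cdot>\<^bsub>C\<^esub> h = \<mu> j)))"

text \<open>Every finite category is isomorphic to one whose objects and arrows are natural numbers,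
  so the shapes of finite diagrams may be taken over the type \<^typ>\<open>nat\<close>.\<close>

definition preserves_finite_limits ::
  "('o1, 'a1) cat \<Rightarrow> ('o2, 'a2) cat \<Rightarrow> ('o1, 'a1, 'o2, 'a2) func \<Rightarrow> bool" where
  "preserves_finite_limits C C' F \<longleftrightarrow>
     (\<forall>(J :: (nat, nat) cat) D L \<pi>.
        category J \<longrightarrow> finite (Ob J) \<longrightarrow> finite (Arr J) \<longrightarrow> is_functor J C D \<longrightarrow>
        is_limit J C D L \<pi> \<longrightarrow>
        is_limit J C' (comp_func F D) (on_ob F L) (\<lambda>j. on_arr F (\<pi> j)))"

definition is_terminal :: "('o, 'a) cat \<Rightarrow> 'o \<Rightarrow> bool" where
  "is_terminal C T \<longleftrightarrow> T \<in> Ob C \<and> (\<forall>X \<in> Ob C. \<exists>!h. h \<in> Hom C X T)"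

definition is_product :: "('o, 'a) cat \<Rightarrow> nat \<Rightarrow> (nat \<Rightarrow> 'o) \<Rightarrow> 'o \<Rightarrow> (nat \<Rightarrow> 'a) \<Rightarrow> bool" where
  "is_product C n X P \<pi> \<longleftrightarrow> P \<in> Ob C \<and> (\<forall>i < n. \<pi> i \<in> Hom C P (X i)) \<and>
     (\<forall>Z \<in> Ob C. \<forall>f. (\<forall>i < n. f i \<in> Hom C Z (X i)) \<longrightarrow>
        (\<exists>!h. h \<in> Hom C Z P \<and> (\<forall>i < n. \<pi> i \<cdot>\<^bsub>C\<^esub> h = f i)))"

text \<open>The case \<open>n = 0\<close> is the existence of a terminal object.\<close>

definition has_finite_products :: "('o, 'a) cat \<Rightarrow> bool" where
  "has_finite_products C \<longleftrightarrow>
     (\<forall>n X. (\<forall>i < n. X i \<in> Ob C) \<longrightarrow> (\<exists>P \<pi>. is_product C n X P \<pi>))"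

definition is_binary_product :: "('o, 'a) cat \<Rightarrow> 'o \<Rightarrow> 'o \<Rightarrow> 'o \<Rightarrow> 'a \<Rightarrow> 'a \<Rightarrow> bool" where
  "is_binary_product C A B P p q \<longleftrightarrow> P \<in> Ob C \<and> p \<in> Hom C P A \<and> q \<in> Hom C P B \<and>
     (\<forall>Z \<in> Ob C. \<forall>f \<in> Hom C Z A. \<forall>g \<in> Hom C Z B.
        \<exists>!h. h \<in> Hom C Z P \<and> p \<cdot>\<^bsub>C\<^esub> h = f \<and> q \<cdot>\<^bsub>C\<^esub> h = g)"

definition is_pullback :: "('o, 'a) cat \<Rightarrow> 'a \<Rightarrow> 'a \<Rightarrow> 'a \<Rightarrow> 'a \<Rightarrow> bool" where
  "is_pullback C f g p q \<longleftrightarrow> f \<in> Arr C \<and> g \<in> Arr C \<and> p \<in> Arr C \<and> q \<in> Arr C \<and>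
     Cod C f = Cod C g \<and> Dom C p = Dom C q \<and> Cod C p = Dom C f \<and> Cod C q = Dom C g \<and>
     f \<cdot>\<^bsub>C\<^esub> p = g \<cdot>\<^bsub>C\<^esub> q \<and>
     (\<forall>Z \<in> Ob C. \<forall>a \<in> Hom C Z (Dom C f). \<forall>b \<in> Hom C Z (Dom C g).
        f \<cdot>\<^bsub>C\<^esub> a = g \<cdot>\<^bsub>C\<^esub> b \<longrightarrow>
        (\<exists>!h. h \<in> Hom C Z (Dom C p) \<and> p \<cdot>\<^bsub>C\<^esub> h = a \<and> q \<cdot>\<^bsub>C\<^esub> h = b))"


section \<open>Cartesian closed and locally cartesian closed categories\<close>

text \<open>\<open>E\<close> is an exponential of \<open>B\<close> by \<open>A\<close> with evaluation \<open>ev : P \<rightarrow> B\<close>, where \<open>P\<close> is a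
  product of \<open>E\<close> and \<open>A\<close> with projections \<open>p\<close>, \<open>q\<close>. The arrow \<open>u\<close> below is \<open>g \<times> A\<close>.\<close>

definition is_exponential :: "('o, 'a) cat \<Rightarrow> 'o \<Rightarrow> 'o \<Rightarrow> 'o \<Rightarrow> 'o \<Rightarrow> 'a \<Rightarrow> 'a \<Rightarrow> 'a \<Rightarrow> bool" where
  "is_exponential C A B E P p q ev \<longleftrightarrow>
     is_binary_product C E A P p q \<and> ev \<in> Hom C P B \<and>
     (\<forall>Z R r s f. Z \<in> Ob C \<longrightarrow> is_binary_product C Z A R r s \<longrightarrow> f \<in> Hom C R B \<longrightarrow>
        (\<exists>!g. g \<in> Hom C Z E \<and>
              (\<exists>u \<in> Hom C R P. p \<cdot>\<^bsub>C\<^esub> u = g \<cdot>\<^bsub>C\<^esub> r \<and> q \<cdot>\<^bsub>C\<^esub> u = s \<and> ev \<cdot>\<^bsub>C\<^esub> u = f)))"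

definition cartesian_closed :: "('o, 'a) cat \<Rightarrow> bool" where
  "cartesian_closed C \<longleftrightarrow> category C \<and> has_finite_products C \<and>
     (\<forall>A \<in> Ob C. \<forall>B \<in> Ob C. \<exists>E P p q ev. is_exponential C A B E P p q ev)"

text \<open>The objects of the slice over \<open>I\<close> are the arrows with codomain \<open>I\<close>. An arrow from \<open>p\<close> to \<open>q\<close>
  is the triple \<open>(p, f, q)\<close>, with \<open>f\<close> an arrow of \<open>C\<close> such that \<open>q \<cdot> f = p\<close>.\<close>

definition slice :: "('o, 'a) cat \<Rightarrow> 'o \<Rightarrow> ('a, 'a \<times> 'a \<times> 'a) cat" where
  "slice C I =
     \<lparr>Ob = {p \<in> Arr C. Cod C p = I},
      Arr = {(p, f, q). p \<in> Arr C \<and> Cod C p = I \<and> q \<in> Arr C \<and> Cod C q = I \<and>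
                        f \<in> Hom C (Dom C p) (Dom C q) \<and> q \<cdot>\<^bsub>C\<^esub> f = p},
      Dom = (\<lambda>(p, f, q). p),
      Cod = (\<lambda>(p, f, q). q),
      Id = (\<lambda>p. (p, Id C (Dom C p), p)),
      Cmp = (\<lambda>(p', g, q') (p, f, q). (p, g \<cdot>\<^bsub>C\<^esub> f, q'))\<rparr>"

definition locally_cartesian_closed :: "('o, 'a) cat \<Rightarrow> bool" where
  "locally_cartesian_closed C \<longleftrightarrow> category C \<and> (\<forall>I \<in> Ob C. cartesian_closed (slice C I))"


section \<open>Models of guarded recursive terms\<close>

definition guarded_model :: "('o, 'a) cat \<Rightarrow> ('o, 'a, 'o, 'a) func \<Rightarrow> ('o \<Rightarrow> 'a) \<Rightarrow> bool" where
  "guarded_model C later nxt \<longleftrightarrow>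
     category C \<and> has_finite_products C \<and>
     is_functor C C later \<and> preserves_finite_limits C C later \<and>
     is_nat_trans C C id_func later nxt \<and>
     (\<forall>T X f. is_terminal C T \<longrightarrow> X \<in> Ob C \<longrightarrow> f \<in> Hom C (on_ob later X) X \<longrightarrow>
        (\<exists>!h. h \<in> Hom C T X \<and> f \<cdot>\<^bsub>C\<^esub> nxt X \<cdot>\<^bsub>C\<^esub> h = h))"


section \<open>The later functor on a slice\<close>

text \<open>The functor \<open>C/I \<rightarrow> D/F I\<close> that applies \<open>F\<close> to arrows into \<open>I\<close>.\<close>

definition slice_map :: "('o1, 'a1, 'o2, 'a2) func \<Rightarrow>
    ('a1, 'a1 \<times> 'a1 \<times> 'a1, 'a2, 'a2 \<times> 'a2 \<times> 'a2) func" where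
  "slice_map F =
     \<lparr>on_ob = (\<lambda>p. on_arr F p),
      on_arr = (\<lambda>(p, f, q). (on_arr F p, on_arr F f, on_arr F q))\<rparr>"

text \<open>A choice of pullbacks along \<open>u : I \<rightarrow> K\<close>: for every \<open>q : Y \<rightarrow> K\<close>, the arrow
  \<open>fst (pb q)\<close> is the projection to \<open>I\<close> and \<open>snd (pb q)\<close> is the projection to \<open>Y\<close>.\<close>

definition pullback_choice :: "('o, 'a) cat \<Rightarrow> 'a \<Rightarrow> ('a \<Rightarrow> 'a \<times> 'a) \<Rightarrow> bool" where
  "pullback_choice C u pb \<longleftrightarrow>
     (\<forall>q \<in> Arr C. Cod C q = Cod C u \<longrightarrow> is_pullback C u q (fst (pb q)) (snd (pb q)))"

text \<open>In a locally cartesian closed category such choices exist, since a binary product in a slice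
  is a pullback.\<close>

lemma pullback_choice_exists:
  assumes "locally_cartesian_closed C" and u: "u \<in> Arr C"
  shows "\<exists>pb. pullback_choice C u pb"
proof -
  interpret category C using assms(1) by (simp add: locally_cartesian_closed_def)
  have "\<exists>pb. is_pullback C u q (fst pb) (snd pb)" if q: "q \<in> Arr C" "Cod C q = Cod C u" for q
  proof -
    let ?S = "slice C (Cod C u)"
    have "has_finite_products ?S"
      using assms Cod_in_Ob by (simp add: locally_cartesian_closed_def cartesian_closed_def)
    moreover have "\<forall>i<(2::nat). (if i = 0 then u else q) \<in> Ob ?S"
      using u q by (auto simp: slice_def)
    ultimately have "\<exists>P \<pi>. is_product ?S 2 (\<lambda>i. if i = 0 then u else q) P \<pi>"
      using has_finite_products_def[THEN iffD1, rule_format, of ?S 2 "\<lambda>i. if i = 0 then u else q"]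
      by simp
    then obtain P \<pi> where P: "is_product ?S 2 (\<lambda>i. if i = 0 then u else q) P \<pi>"
      by blast
    then have "\<forall>i<2. \<pi> i \<in> Hom ?S P (if i = 0 then u else q)"
      by (simp add: is_product_def)
    from this[rule_format, of 0] this[rule_format, of 1]
    have \<pi>S: "\<pi> 0 \<in> Hom ?S P u" "\<pi> 1 \<in> Hom ?S P q"
      by simp_all
    have S: "(f \<in> Hom ?S x y) \<longleftrightarrow> (\<exists>k. f = (x, k, y) \<and> x \<in> Arr C \<and> Cod C x = Cod C u \<and>
        y \<in> Arr C \<and> Cod C y = Cod C u \<and> k \<in> Hom C (Dom C x) (Dom C y) \<and> y \<cdot>\<^bsub>C\<^esub> k = x)"
      for f x y by (cases f) (auto simp: slice_def Hom_def)
    have Cmp_S: "(y, k, z) \<cdot>\<^bsub>?S\<^esub> (x, l, y') = (x, k \<cdot>\<^bsub>C\<^esub> l, z)" for x y y' z k l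
      by (simp add: slice_def)
    from \<pi>S obtain a b where \<pi>: "\<pi> 0 = (P, a, u)" "\<pi> 1 = (P, b, q)"
      and a: "a \<in> Hom C (Dom C P) (Dom C u)" "u \<cdot>\<^bsub>C\<^esub> a = P"
      and b: "b \<in> Hom C (Dom C P) (Dom C q)" "q \<cdot>\<^bsub>C\<^esub> b = P"
      and PA: "P \<in> Arr C" "Cod C P = Cod C u"
      unfolding S by blast
    have "\<exists>!h. h \<in> Hom C Z (Dom C P) \<and> a \<cdot>\<^bsub>C\<^esub> h = c \<and> b \<cdot>\<^bsub>C\<^esub> h = d"
      if Z: "Z \<in> Ob C" and c: "c \<in> Hom C Z (Dom C u)" and d: "d \<in> Hom C Z (Dom C q)"
        and eq: "u \<cdot>\<^bsub>C\<^esub> c = q \<cdot>\<^bsub>C\<^esub> d" for Z c d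
    proof -
      let ?z = "u \<cdot>\<^bsub>C\<^esub> c"
      have uH: "u \<in> Hom C (Dom C u) (Cod C u)" using u by (simp add: Hom_def)
      have zH: "?z \<in> Hom C Z (Cod C u)" by (rule Cmp_in_Hom[OF c uH])
      have zS: "?z \<in> Ob ?S" using zH by (simp add: slice_def Hom_def)
      let ?f = "\<lambda>i::nat. if i = 0 then (?z, c, u) else (?z, d, q)"
      have fS: "\<forall>i<2. ?f i \<in> Hom ?S ?z (if i = 0 then u else q)"
        using zH c d eq u q by (auto simp: slice_def Hom_def)
      have all2: "(\<forall>i<2. Q i) \<longleftrightarrow> Q 0 \<and> Q 1" for Q :: "nat \<Rightarrow> bool"
        by (auto simp: less_2_cases_iff)
      have "\<exists>!h. h \<in> Hom ?S ?z P \<and> (\<forall>i<2. \<pi> i \<cdot>\<^bsub>?S\<^esub> h = ?f i)"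
        by (rule P[unfolded is_product_def, THEN conjunct2, THEN conjunct2, THEN bspec, OF zS,
              THEN spec, THEN mp, OF fS])
      then have ex1: "\<exists>!h. h \<in> Hom ?S ?z P \<and> \<pi> 0 \<cdot>\<^bsub>?S\<^esub> h = (?z, c, u) \<and> \<pi> 1 \<cdot>\<^bsub>?S\<^esub> h = (?z, d, q)"
        unfolding all2 by (simp only: if_True if_False simp_thms one_neq_zero)
      have iff: "(?z, h, P) \<in> Hom ?S ?z P \<and> \<pi> 0 \<cdot>\<^bsub>?S\<^esub> (?z, h, P) = (?z, c, u) \<and>
            \<pi> 1 \<cdot>\<^bsub>?S\<^esub> (?z, h, P) = (?z, d, q) \<longleftrightarrow>
          h \<in> Hom C Z (Dom C P) \<and> a \<cdot>\<^bsub>C\<^esub> h = c \<and> b \<cdot>\<^bsub>C\<^esub> h = d" for h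
      proof -
        have "P \<cdot>\<^bsub>C\<^esub> h = ?z" if "h \<in> Hom C Z (Dom C P)" "a \<cdot>\<^bsub>C\<^esub> h = c"
          using Cmp_assoc[OF that(1) a(1) uH] that(2) a(2) by simp
        moreover have "Dom C ?z = Z" "?z \<in> Arr C" "Cod C ?z = Cod C u"
          using zH by (simp_all add: Hom_def)
        ultimately show ?thesis
          using PA unfolding S \<pi> Cmp_S prod.inject by metis
      qed
      have shape: "\<exists>k. h = (?z, k, P)" if "h \<in> Hom ?S ?z P" for h
        using that unfolding S by blast
      from ex1 obtain h where h: "h \<in> Hom ?S ?z P \<and> \<pi> 0 \<cdot>\<^bsub>?S\<^esub> h = (?z, c, u) \<and> \<pi> 1 \<cdot>\<^bsub>?S\<^esub> h = (?z, d, q)"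
        by blast
      with shape obtain k where k: "h = (?z, k, P)" by blast
      show ?thesis
      proof (rule ex1I[of _ k])
        show "k \<in> Hom C Z (Dom C P) \<and> a \<cdot>\<^bsub>C\<^esub> k = c \<and> b \<cdot>\<^bsub>C\<^esub> k = d"
          using h iff[of k] unfolding k by simp
        fix l assume "l \<in> Hom C Z (Dom C P) \<and> a \<cdot>\<^bsub>C\<^esub> l = c \<and> b \<cdot>\<^bsub>C\<^esub> l = d"
        then have "(?z, l, P) = h" using iff[of l] ex1 h by metis
        then show "l = k" using k by simp
      qed
    qed
    moreover have "a \<in> Arr C" "b \<in> Arr C" "Dom C a = Dom C P" "Dom C b = Dom C P"
        "Cod C a = Dom C u" "Cod C b = Dom C q"
      using a b by (simp_all add: Hom_def)
    ultimately have "is_pullback C u q a b"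
      using u q a(2) b(2) by (simp add: is_pullback_def)
    then show ?thesis by (metis fst_conv snd_conv)
  qed
  then show ?thesis unfolding pullback_choice_def by metis
qed

definition pullback_map :: "('o, 'a) cat \<Rightarrow> ('a \<Rightarrow> 'a \<times> 'a) \<Rightarrow>
    ('a, 'a \<times> 'a \<times> 'a, 'a, 'a \<times> 'a \<times> 'a) func" where
  "pullback_map C pb =
     \<lparr>on_ob = (\<lambda>q. fst (pb q)),
      on_arr = (\<lambda>(q, f, r).
        (fst (pb q),
         (THE h. h \<in> Hom C (Dom C (fst (pb q))) (Dom C (fst (pb r))) \<and>
                 fst (pb r) \<cdot>\<^bsub>C\<^esub> h = fst (pb q) \<and>
                 snd (pb r) \<cdot>\<^bsub>C\<^esub> h = f \<cdot>\<^bsub>C\<^esub> snd (pb q)),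
         fst (pb r)))\<rparr>"

text \<open>For \<open>pb\<close> a choice of pullbacks along \<open>nxt I\<close>, this is the composite
  \<open>C/I \<rightarrow> C/later I \<rightarrow> C/I\<close>.\<close>

definition later_slice :: "('o, 'a) cat \<Rightarrow> ('o, 'a, 'o, 'a) func \<Rightarrow> ('a \<Rightarrow> 'a \<times> 'a) \<Rightarrow>
    ('a, 'a \<times> 'a \<times> 'a, 'a, 'a \<times> 'a \<times> 'a) func" where
  "later_slice C later pb = comp_func (pullback_map C pb) (slice_map later)"

definition next_slice :: "('o, 'a) cat \<Rightarrow> ('o, 'a, 'o, 'a) func \<Rightarrow> ('o \<Rightarrow> 'a) \<Rightarrow>
    ('a \<Rightarrow> 'a \<times> 'a) \<Rightarrow> 'a \<Rightarrow> 'a \<times> 'a \<times> 'a" where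
  "next_slice C later nxt pb p =
     (let (a, b) = pb (on_arr later p) in
        (p,
         (THE h. h \<in> Hom C (Dom C p) (Dom C a) \<and> a \<cdot>\<^bsub>C\<^esub> h = p \<and> b \<cdot>\<^bsub>C\<^esub> h = nxt (Dom C p)),
         a))"

end

theory Submission
  imports Defs
begin

text \<open>A limit in a slice is a limit in the base of the diagram extended by a terminal object, so
  applying \<open>later\<close> to arrows into \<open>I\<close> preserves finite limits; pulling back along \<open>nxt I\<close> preserves
  all limits. For fixed points, a terminal object of the slice is isomorphic to the identity of \<open>I\<close>,
  so one looks for a section of \<open>p : X \<rightarrow> I\<close>. Sections are points of the object \<open>S\<close> of sections of \<open>p\<close>, and
  an arrow \<open>f\<close> from the later of \<open>p\<close> to \<open>p\<close> in the slice induces \<open>later S \<rightarrow> S\<close>, to which the fixed point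
  property of the base applies. Local cartesian closure passes to the slice because a slice of a
  slice is isomorphic to a slice of the base.\<close>

section \<open>Categories and slices\<close>

text \<open>The fixed point axiom speaks only of points \<open>1 -> X\<close>, while a point of
  \<open>p\<close> in the slice is a section over \<open>I\<close>. The dependence on
  \<open>I\<close> has to be absorbed into a single object, and this is where exponentials of the
  base enter. They come from the slice over a terminal object, because
  \<open>locally_cartesian_closed\<close> speaks of slices alone. Nothing makes \<open>later\<close>
  commute with exponentials or with the object \<open>S\<close> of sections. Only a map in one
  direction is required, from \<open>later S \<times> I\<close> to \<open>later X\<close>. It exists
  because \<open>later\<close> preserves the binary product \<open>S \<times> I\<close> and because
  \<open>nxt I\<close> leads from \<open>I\<close> to \<open>later I\<close>. Uniqueness passes back
  to the slice since points of \<open>S\<close> and sections of \<open>p\<close> correspond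
  bijectively. Pulling back along \<open>u\<close> preserves limits because it is right adjoint to
  composition with \<open>u\<close>; the adjunction is used by transposing cones by hand. A second
  constraint is that \<open>preserves_finite_limits\<close> quantifies over shapes on
  \<open>nat\<close>, so an extended shape must again be coded by natural numbers.\<close>

lemma in_Hom_iff: "f \<in> Hom C X Y \<longleftrightarrow> f \<in> Arr C \<and> Dom C f = X \<and> Cod C f = Y"
  by (simp add: Hom_def)

context category
begin

lemma Id_simps [simp]:
  assumes "X \<in> Ob C"
  shows "Id C X \<in> Arr C" "Dom C (Id C X) = X" "Cod C (Id C X) = X"
  using Id_in_Hom[OF assms] by (simp_all add: in_Hom_iff)

lemma Cmp_simps [simp]:
  assumes "f \<in> Arr C" "g \<in> Arr C" "Dom C g = Cod C f"
  shows "g \<cdot> f \<in> Arr C" "Dom C (g \<cdot> f) = Dom C f" "Cod C (g \<cdot> f) = Cod C g"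
  using Cmp_in_Hom[of f "Dom C f" "Cod C f" g "Cod C g"] assms by (simp_all add: in_Hom_iff)

lemma Cmp_assoc_Arr [simp]:
  assumes "f \<in> Arr C" "g \<in> Arr C" "h \<in> Arr C" "Dom C g = Cod C f" "Dom C h = Cod C g"
  shows "(h \<cdot> g) \<cdot> f = h \<cdot> (g \<cdot> f)"
  using Cmp_assoc[of f "Dom C f" "Cod C f" g "Cod C g" h "Cod C h"] assms
  by (simp add: in_Hom_iff)

lemma Cmp_Id_Arr [simp]:
  assumes "f \<in> Arr C"
  shows "Cod C f = X \<Longrightarrow> Id C X \<cdot> f = f" "Dom C f = X \<Longrightarrow> f \<cdot> Id C X = f"
  using Cmp_Id_left[of f "Dom C f" "Cod C f"] Cmp_Id_right[of f "Dom C f" "Cod C f"] assms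
  by (auto simp add: in_Hom_iff)

declare Dom_in_Ob [simp] Cod_in_Ob [simp]

text \<open>Simplification associates composites to the right, so an equation
  \<open>h \<cdot> g = k\<close> no longer matches inside \<open>h \<cdot> (g \<cdot> f)\<close>.
  Applied with \<open>THEN\<close>, this rule turns such an equation into a rewrite rule that does
  match.\<close>

lemma Cmp_reassoc:
  assumes "h \<cdot> g = k" "f \<in> Arr C" "g \<in> Arr C" "h \<in> Arr C" "Dom C g = Cod C f" "Dom C h = Cod C g"
  shows "h \<cdot> (g \<cdot> f) = k \<cdot> f"
  using Cmp_assoc_Arr[OF assms(2-6)] assms(1) by simp

end

lemma slice_simps [simp]:
  "p \<in> Ob (slice C I) \<longleftrightarrow> p \<in> Arr C \<and> Cod C p = I"
  "Dom (slice C I) (p, f, q) = p"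
  "Cod (slice C I) (p, f, q) = q"
  "Id (slice C I) p = (p, Id C (Dom C p), p)"
  "(p', g, q') \<cdot>\<^bsub>slice C I\<^esub> (p, f, q) = (p, g \<cdot>\<^bsub>C\<^esub> f, q')"
  by (simp_all add: slice_def)

lemma Arr_slice_iff [simp]:
  "(p, f, q) \<in> Arr (slice C I) \<longleftrightarrow> p \<in> Arr C \<and> Cod C p = I \<and> q \<in> Arr C \<and> Cod C q = I \<and>
     f \<in> Arr C \<and> Dom C f = Dom C p \<and> Cod C f = Dom C q \<and> q \<cdot>\<^bsub>C\<^esub> f = p"
  by (auto simp add: slice_def in_Hom_iff)

lemma Hom_slice_iff:
  "h \<in> Hom (slice C I) p q \<longleftrightarrow> (\<exists>f. h = (p, f, q) \<and> p \<in> Arr C \<and> Cod C p = I \<and> q \<in> Arr C \<and>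
     Cod C q = I \<and> f \<in> Arr C \<and> Dom C f = Dom C p \<and> Cod C f = Dom C q \<and> q \<cdot>\<^bsub>C\<^esub> f = p)"
  by (cases h) (auto simp add: in_Hom_iff)

text \<open>Substituting away \<open>p\<close> by means of \<open>q \<cdot> f = p\<close> makes \<open>Dom C f = Dom C p\<close> a looping rewrite rule,
  hence the elimination rule for use with \<open>simp\<close> instead of \<open>auto\<close>.\<close>

lemma Hom_sliceE:
  assumes "h \<in> Hom (slice C I) p q"
  obtains f where "h = (p, f, q)" "p \<in> Arr C" "Cod C p = I" "q \<in> Arr C" "Cod C q = I"
    "f \<in> Arr C" "Dom C f = Dom C p" "Cod C f = Dom C q" "q \<cdot>\<^bsub>C\<^esub> f = p"
  using assms unfolding Hom_slice_iff by blast

lemma Hom_slice_shape: "h \<in> Hom (slice C I) p q \<Longrightarrow> h = (p, fst (snd h), q)"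
  by (elim Hom_sliceE) simp

lemma (in category) category_slice: "category (slice C I)"
proof
  fix f assume "f \<in> Arr (slice C I)"
  then show "Dom (slice C I) f \<in> Ob (slice C I)" "Cod (slice C I) f \<in> Ob (slice C I)"
    by (cases f; simp)+
next
  fix X assume "X \<in> Ob (slice C I)"
  then show "Id (slice C I) X \<in> Hom (slice C I) X X"
    by (simp add: Hom_slice_iff)
next
  fix f g X Y Z assume f: "f \<in> Hom (slice C I) X Y" and g: "g \<in> Hom (slice C I) Y Z"
  from f g show "g \<cdot>\<^bsub>slice C I\<^esub> f \<in> Hom (slice C I) X Z"
  proof (elim Hom_sliceE)
    fix f' g' assume "f = (X, f', Y)" "g = (Y, g', Z)" and f: "f' \<in> Arr C" "Dom C f' = Dom C X"
      "Cod C f' = Dom C Y" "Y \<cdot> f' = X" and g: "g' \<in> Arr C" "Dom C g' = Dom C Y"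
      "Cod C g' = Dom C Z" "Z \<cdot> g' = Y" and XZ: "X \<in> Arr C" "Cod C X = I" "Z \<in> Arr C" "Cod C Z = I"
    moreover from f g XZ(3) have "Z \<cdot> (g' \<cdot> f') = X"
      using Cmp_reassoc[of Z g' Y f'] by simp
    ultimately show ?thesis by (simp add: in_Hom_iff)
  qed
next
  fix f X Y assume "f \<in> Hom (slice C I) X Y"
  then show "Id (slice C I) Y \<cdot>\<^bsub>slice C I\<^esub> f = f" "f \<cdot>\<^bsub>slice C I\<^esub> Id (slice C I) X = f"
    by (elim Hom_sliceE; simp)+
next
  fix f g h W X Y Z
  assume "f \<in> Hom (slice C I) W X" "g \<in> Hom (slice C I) X Y" "h \<in> Hom (slice C I) Y Z"
  then show "(h \<cdot>\<^bsub>slice C I\<^esub> g) \<cdot>\<^bsub>slice C I\<^esub> f = h \<cdot>\<^bsub>slice C I\<^esub> (g \<cdot>\<^bsub>slice C I\<^esub> f)"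
    by (elim Hom_sliceE) simp
qed

section \<open>Universal properties of pullbacks, binary products and terminal objects\<close>

lemma pullback_ex1:
  assumes "is_pullback C f g p q" "Z \<in> Ob C" "a \<in> Hom C Z (Dom C f)" "b \<in> Hom C Z (Dom C g)"
    "f \<cdot>\<^bsub>C\<^esub> a = g \<cdot>\<^bsub>C\<^esub> b"
  shows "\<exists>!h. h \<in> Hom C Z (Dom C p) \<and> p \<cdot>\<^bsub>C\<^esub> h = a \<and> q \<cdot>\<^bsub>C\<^esub> h = b"
  using assms unfolding is_pullback_def by blast

lemma (in category) pullback_eqI:
  assumes pb: "is_pullback C f g p q"
    and h: "h \<in> Hom C Z (Dom C p)" and h': "h' \<in> Hom C Z (Dom C p)"
    and eq: "p \<cdot> h = p \<cdot> h'" "q \<cdot> h = q \<cdot> h'"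
  shows "h = h'"
proof -
  have "f \<in> Arr C" "g \<in> Arr C" "p \<in> Arr C" "q \<in> Arr C" "Cod C f = Cod C g" "Dom C p = Dom C q"
    "Cod C p = Dom C f" "Cod C q = Dom C g" "f \<cdot> p = g \<cdot> q"
    using pb by (simp_all add: is_pullback_def)
  then have "f \<cdot> (p \<cdot> h) = g \<cdot> (q \<cdot> h)" "p \<cdot> h \<in> Hom C Z (Dom C f)" "q \<cdot> h \<in> Hom C Z (Dom C g)"
    "Z \<in> Ob C"
    using h by (auto simp: in_Hom_iff Cmp_reassoc[of f p "g \<cdot> q"])
  from pullback_ex1[OF pb this(4,2,3,1)] show ?thesis
    using h h' eq by metis
qed

lemma binary_product_ex1:
  assumes "is_binary_product C A B P p q" "Z \<in> Ob C" "f \<in> Hom C Z A" "g \<in> Hom C Z B"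
  shows "\<exists>!h. h \<in> Hom C Z P \<and> p \<cdot>\<^bsub>C\<^esub> h = f \<and> q \<cdot>\<^bsub>C\<^esub> h = g"
  using assms by (simp add: is_binary_product_def)

lemma (in category) binary_product_eqI:
  assumes P: "is_binary_product C A B P p q"
    and h: "h \<in> Hom C Z P" and h': "h' \<in> Hom C Z P"
    and eq: "p \<cdot> h = p \<cdot> h'" "q \<cdot> h = q \<cdot> h'"
  shows "h = h'"
proof -
  have "p \<in> Hom C P A" "q \<in> Hom C P B" "Z \<in> Ob C"
    using P h by (auto simp: is_binary_product_def in_Hom_iff)
  then have "p \<cdot> h \<in> Hom C Z A" "q \<cdot> h \<in> Hom C Z B"
    using h by (auto intro: Cmp_in_Hom)
  from binary_product_ex1[OF P \<open>Z \<in> Ob C\<close> this] show ?thesis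
    using h h' eq by metis
qed

lemma has_binary_products:
  assumes fp: "has_finite_products C" and A: "A \<in> Ob C" and B: "B \<in> Ob C"
  obtains P p q where "is_binary_product C A B P p q"
proof -
  let ?X = "\<lambda>i::nat. if i = 0 then A else B"
  have all2: "(\<forall>i<2. Q i) \<longleftrightarrow> Q 0 \<and> Q (Suc 0)" for Q :: "nat \<Rightarrow> bool"
    by (auto simp: less_2_cases_iff)
  obtain P \<pi> where P: "is_product C 2 ?X P \<pi>"
    using fp[unfolded has_finite_products_def, THEN spec, THEN spec, of 2 ?X] A B by auto
  have "\<exists>!h. h \<in> Hom C Z P \<and> \<pi> 0 \<cdot>\<^bsub>C\<^esub> h = f \<and> \<pi> (Suc 0) \<cdot>\<^bsub>C\<^esub> h = g"
    if "Z \<in> Ob C" "f \<in> Hom C Z A" "g \<in> Hom C Z B" for Z f g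
  proof -
    let ?f = "\<lambda>i::nat. if i = 0 then f else g"
    have f: "\<forall>i<2. ?f i \<in> Hom C Z (?X i)"
      using that by simp
    have "\<exists>!h. h \<in> Hom C Z P \<and> (\<forall>i<2. \<pi> i \<cdot>\<^bsub>C\<^esub> h = ?f i)"
      by (rule P[unfolded is_product_def, THEN conjunct2, THEN conjunct2, THEN bspec, OF that(1),
            THEN spec, THEN mp, OF f])
    then show ?thesis unfolding all2 by simp
  qed
  then have "is_binary_product C A B P (\<pi> 0) (\<pi> (Suc 0))"
    using P by (simp add: is_binary_product_def is_product_def all2)
  then show thesis by (rule that)
qed

lemma has_terminal:
  assumes "has_finite_products C"
  obtains T where "is_terminal C T"
proof -
  obtain P \<pi> where "is_product C 0 (\<lambda>_. undefined) P \<pi>"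
    using assms[unfolded has_finite_products_def, THEN spec, THEN spec, of 0 "\<lambda>_. undefined"] by auto
  then have "is_terminal C P"
    by (simp add: is_product_def is_terminal_def)
  then show thesis by (rule that)
qed

section \<open>Isomorphisms of categories\<close>

text \<open>Both comparisons needed later, of a slice over a terminal object with the base and of an
  iterated slice with a slice, are bijective on objects and on arrows. Universal properties can
  therefore be transported by renaming, without coherence isomorphisms.\<close>

locale category_iso =
  fixes C :: "('o1, 'a1) cat" and D :: "('o2, 'a2) cat" and F :: "('o1, 'a1, 'o2, 'a2) func"
  assumes functorial: "is_functor C D F"
    and bij_ob: "bij_betw (on_ob F) (Ob C) (Ob D)"
    and bij_arr: "bij_betw (on_arr F) (Arr C) (Arr D)"
begin

sublocale C: category C
  using functorial by (simp add: is_functor_def)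

sublocale D: category D
  using functorial by (simp add: is_functor_def)

lemma on_arr_Hom_iff:
  assumes "f \<in> Arr C" "X \<in> Ob C" "Y \<in> Ob C"
  shows "on_arr F f \<in> Hom D (on_ob F X) (on_ob F Y) \<longleftrightarrow> f \<in> Hom C X Y"
proof -
  have "on_arr F f \<in> Hom D (on_ob F (Dom C f)) (on_ob F (Cod C f))"
    using functorial assms by (simp add: is_functor_def)
  moreover have "inj_on (on_ob F) (Ob C)"
    using bij_ob by (rule bij_betw_imp_inj_on)
  ultimately show ?thesis
    using assms by (auto simp: in_Hom_iff dest: inj_onD)
qed

lemma on_arr_Cmp:
  "f \<in> Hom C X Y \<Longrightarrow> g \<in> Hom C Y Z \<Longrightarrow> on_arr F g \<cdot>\<^bsub>D\<^esub> on_arr F f = on_arr F (g \<cdot>\<^bsub>C\<^esub> f)"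
  using functorial by (simp add: is_functor_def in_Hom_iff)

lemma on_arr_eq_iff: "f \<in> Arr C \<Longrightarrow> g \<in> Arr C \<Longrightarrow> on_arr F f = on_arr F g \<longleftrightarrow> f = g"
  using bij_arr by (auto simp: bij_betw_def dest: inj_onD)

lemma on_arr_Cmp_eq_iff:
  assumes "f \<in> Hom C X Y" "g \<in> Hom C Y Z" "k \<in> Arr C"
  shows "on_arr F g \<cdot>\<^bsub>D\<^esub> on_arr F f = on_arr F k \<longleftrightarrow> g \<cdot>\<^bsub>C\<^esub> f = k"
  using on_arr_Cmp[OF assms(1,2)] C.Cmp_in_Hom[OF assms(1,2)] assms(3)
  by (simp add: in_Hom_iff on_arr_eq_iff)

lemma Ball_Ob_iff: "(\<forall>X\<in>Ob D. P X) \<longleftrightarrow> (\<forall>X\<in>Ob C. P (on_ob F X))"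
  using bij_ob unfolding bij_betw_def by (metis (no_types, lifting) image_iff)

lemma on_ob_Ob: "X \<in> Ob C \<Longrightarrow> on_ob F X \<in> Ob D"
  using bij_ob by (auto simp: bij_betw_def)

lemma Hom_image:
  assumes "X \<in> Ob C" "Y \<in> Ob C"
  shows "Hom D (on_ob F X) (on_ob F Y) = on_arr F ` Hom C X Y"
proof (intro set_eqI iffI)
  fix g assume g: "g \<in> Hom D (on_ob F X) (on_ob F Y)"
  then obtain f where "f \<in> Arr C" "g = on_arr F f"
    using bij_arr by (auto simp: bij_betw_def in_Hom_iff)
  then show "g \<in> on_arr F ` Hom C X Y"
    using g assms on_arr_Hom_iff by auto
next
  fix g assume "g \<in> on_arr F ` Hom C X Y"
  then show "g \<in> Hom D (on_ob F X) (on_ob F Y)"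
    using assms by (auto simp: on_arr_Hom_iff in_Hom_iff[of _ C])
qed

lemma Ex1_Hom_iff:
  assumes "X \<in> Ob C" "Y \<in> Ob C"
  shows "(\<exists>!h. h \<in> Hom D (on_ob F X) (on_ob F Y) \<and> P h) \<longleftrightarrow>
         (\<exists>!h. h \<in> Hom C X Y \<and> P (on_arr F h))"
proof -
  have "inj_on (on_arr F) (Hom C X Y)"
    using bij_arr by (auto simp: bij_betw_def in_Hom_iff inj_on_def)
  then show ?thesis
    unfolding Hom_image[OF assms] by (auto simp: Ex1_def inj_on_def)
qed

text \<open>Both directions matter: an exponential contains a product, which is carried from
  \<open>C\<close> to \<open>D\<close>, but it is tested against arbitrary products in
  \<open>D\<close>, which have to be carried back to \<open>C\<close>.\<close>

lemma is_binary_product_iff: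
  assumes "A \<in> Ob C" "B \<in> Ob C" "P \<in> Ob C" "p \<in> Arr C" "q \<in> Arr C"
  shows "is_binary_product D (on_ob F A) (on_ob F B) (on_ob F P) (on_arr F p) (on_arr F q) \<longleftrightarrow>
         is_binary_product C A B P p q"
proof (cases "p \<in> Hom C P A \<and> q \<in> Hom C P B")
  case True
  have "(\<exists>!h. h \<in> Hom D (on_ob F Z) (on_ob F P) \<and>
          on_arr F p \<cdot>\<^bsub>D\<^esub> h = on_arr F f \<and> on_arr F q \<cdot>\<^bsub>D\<^esub> h = on_arr F g) \<longleftrightarrow>
        (\<exists>!h. h \<in> Hom C Z P \<and> p \<cdot>\<^bsub>C\<^esub> h = f \<and> q \<cdot>\<^bsub>C\<^esub> h = g)"
    if "Z \<in> Ob C" "f \<in> Hom C Z A" "g \<in> Hom C Z B" for Z f g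
  proof -
    have "h \<in> Hom C Z P \<and> on_arr F p \<cdot>\<^bsub>D\<^esub> on_arr F h = on_arr F f \<and>
            on_arr F q \<cdot>\<^bsub>D\<^esub> on_arr F h = on_arr F g \<longleftrightarrow>
          h \<in> Hom C Z P \<and> p \<cdot>\<^bsub>C\<^esub> h = f \<and> q \<cdot>\<^bsub>C\<^esub> h = g" for h
      using True that on_arr_Cmp_eq_iff[of h Z P] by (auto simp: in_Hom_iff)
    then show ?thesis
      unfolding Ex1_Hom_iff[OF that(1) assms(3)] by simp
  qed
  then show ?thesis
    using True assms
    by (simp add: is_binary_product_def Ball_Ob_iff Hom_image on_ob_Ob)
next
  case False
  then show ?thesis
    using assms by (auto simp: is_binary_product_def on_arr_Hom_iff)
qed

lemma is_product_image:
  assumes P: "is_product C n X P \<pi>" and X: "\<forall>i<n. X i \<in> Ob C"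
  shows "is_product D n (\<lambda>i. on_ob F (X i)) (on_ob F P) (\<lambda>i. on_arr F (\<pi> i))"
proof -
  have P': "P \<in> Ob C" "\<forall>i<n. \<pi> i \<in> Hom C P (X i)"
    using P by (simp_all add: is_product_def)
  have "\<exists>!h. h \<in> Hom D (on_ob F Z) (on_ob F P) \<and> (\<forall>i<n. on_arr F (\<pi> i) \<cdot>\<^bsub>D\<^esub> h = g i)"
    if Z: "Z \<in> Ob C" and g: "\<forall>i<n. g i \<in> Hom D (on_ob F Z) (on_ob F (X i))" for Z g
  proof -
    have "\<forall>i. \<exists>f. i < n \<longrightarrow> f \<in> Hom C Z (X i) \<and> g i = on_arr F f"
      using g X Z by (auto simp: Hom_image)
    then obtain f where f: "\<And>i. i < n \<Longrightarrow> f i \<in> Hom C Z (X i) \<and> g i = on_arr F (f i)"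
      by metis
    have "h \<in> Hom C Z P \<and> (\<forall>i<n. on_arr F (\<pi> i) \<cdot>\<^bsub>D\<^esub> on_arr F h = g i) \<longleftrightarrow>
          h \<in> Hom C Z P \<and> (\<forall>i<n. \<pi> i \<cdot>\<^bsub>C\<^esub> h = f i)" for h
      using f P' on_arr_Cmp_eq_iff[of h Z P] by (auto simp: in_Hom_iff)
    moreover have "\<exists>!h. h \<in> Hom C Z P \<and> (\<forall>i<n. \<pi> i \<cdot>\<^bsub>C\<^esub> h = f i)"
      using P Z f by (simp add: is_product_def)
    ultimately show ?thesis
      unfolding Ex1_Hom_iff[OF Z P'(1)] by simp
  qed
  then show ?thesis
    using P' X by (simp add: is_product_def Ball_Ob_iff on_ob_Ob Hom_image)
qed

lemma is_exponential_image:
  assumes A: "A \<in> Ob C" and B: "B \<in> Ob C" and E: "is_exponential C A B E P p q ev"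
  shows "is_exponential D (on_ob F A) (on_ob F B) (on_ob F E) (on_ob F P)
           (on_arr F p) (on_arr F q) (on_arr F ev)"
proof -
  have prod: "is_binary_product C E A P p q" and ev: "ev \<in> Hom C P B"
    using E by (simp_all add: is_exponential_def)
  have p: "p \<in> Hom C P E" and q: "q \<in> Hom C P A" and PO: "P \<in> Ob C"
    using prod by (auto simp: is_binary_product_def)
  then have EO: "E \<in> Ob C"
    by (auto simp: in_Hom_iff)
  have main: "\<exists>!g. g \<in> Hom D Z (on_ob F E) \<and> (\<exists>u\<in>Hom D R (on_ob F P).
        on_arr F p \<cdot>\<^bsub>D\<^esub> u = g \<cdot>\<^bsub>D\<^esub> r \<and> on_arr F q \<cdot>\<^bsub>D\<^esub> u = s \<and> on_arr F ev \<cdot>\<^bsub>D\<^esub> u = f)"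
    if Z: "Z \<in> Ob D" and R: "is_binary_product D Z (on_ob F A) R r s"
      and f: "f \<in> Hom D R (on_ob F B)" for Z R r s f
  proof -
    have rs: "R \<in> Ob D" "r \<in> Hom D R Z" "s \<in> Hom D R (on_ob F A)"
      using R by (simp_all add: is_binary_product_def)
    \<comment> \<open>All test data in \<open>D\<close> are replaced by their preimages in
      \<open>C\<close>, where the universal property of \<open>E\<close> applies.\<close>
    obtain Z' R' where Z': "Z' \<in> Ob C" "Z = on_ob F Z'" and R': "R' \<in> Ob C" "R = on_ob F R'"
      using Z rs(1) bij_ob unfolding bij_betw_def by (metis imageE)
    obtain r' s' f' where r': "r' \<in> Hom C R' Z'" "r = on_arr F r'"
      and s': "s' \<in> Hom C R' A" "s = on_arr F s'" and f': "f' \<in> Hom C R' B" "f = on_arr F f'"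
      using rs f Z' R' A B by (auto simp: Hom_image)
    have "is_binary_product C Z' A R' r' s'"
      using R Z' R' A r' s' is_binary_product_iff[of Z' A R' r' s'] by (simp add: in_Hom_iff)
    then have ex: "\<exists>!g. g \<in> Hom C Z' E \<and>
        (\<exists>u\<in>Hom C R' P. p \<cdot>\<^bsub>C\<^esub> u = g \<cdot>\<^bsub>C\<^esub> r' \<and> q \<cdot>\<^bsub>C\<^esub> u = s' \<and> ev \<cdot>\<^bsub>C\<^esub> u = f')"
      using E Z' f' by (simp add: is_exponential_def)
    have iff: "on_arr F p \<cdot>\<^bsub>D\<^esub> on_arr F u = on_arr F g \<cdot>\<^bsub>D\<^esub> r \<and> on_arr F q \<cdot>\<^bsub>D\<^esub> on_arr F u = s \<and>
          on_arr F ev \<cdot>\<^bsub>D\<^esub> on_arr F u = f \<longleftrightarrow>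
        p \<cdot>\<^bsub>C\<^esub> u = g \<cdot>\<^bsub>C\<^esub> r' \<and> q \<cdot>\<^bsub>C\<^esub> u = s' \<and> ev \<cdot>\<^bsub>C\<^esub> u = f'"
      if g: "g \<in> Hom C Z' E" and u: "u \<in> Hom C R' P" for g u
    proof -
      have "on_arr F g \<cdot>\<^bsub>D\<^esub> r = on_arr F (g \<cdot>\<^bsub>C\<^esub> r')"
        using on_arr_Cmp[OF r'(1) g] r'(2) by simp
      moreover have "g \<cdot>\<^bsub>C\<^esub> r' \<in> Arr C"
        using C.Cmp_in_Hom[OF r'(1) g] by (simp add: in_Hom_iff)
      ultimately show ?thesis
        using on_arr_Cmp_eq_iff[OF u p] on_arr_Cmp_eq_iff[OF u q] on_arr_Cmp_eq_iff[OF u ev]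
          s' f' by (simp add: in_Hom_iff)
    qed
    show ?thesis
      unfolding Z'(2) R'(2) Ex1_Hom_iff[OF Z'(1) EO] Hom_image[OF R'(1) PO]
      using ex iff by (simp add: bex_simps cong: conj_cong bex_cong)
  qed
  show ?thesis
    unfolding is_exponential_def
    using prod ev p q PO EO A B main is_binary_product_iff[of E A P p q]
    by (auto simp: in_Hom_iff[of p] in_Hom_iff[of q] Hom_image)
qed

lemma cartesian_closed_image:
  assumes cc: "cartesian_closed C"
  shows "cartesian_closed D"
proof -
  have "\<exists>P \<pi>. is_product D n X P \<pi>" if X: "\<forall>i<n. X i \<in> Ob D" for n X
  proof -
    let ?Y = "\<lambda>i. inv_into (Ob C) (on_ob F) (X i)"
    have Y: "\<forall>i<n. ?Y i \<in> Ob C \<and> on_ob F (?Y i) = X i"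
      using X bij_ob by (auto simp: bij_betw_def intro: inv_into_into f_inv_into_f)
    then obtain P \<pi> where "is_product C n ?Y P \<pi>"
      using cc unfolding cartesian_closed_def has_finite_products_def by meson
    from is_product_image[OF this] Y
    have "is_product D n (\<lambda>i. on_ob F (?Y i)) (on_ob F P) (\<lambda>i. on_arr F (\<pi> i))"
      by simp
    then have "is_product D n X (on_ob F P) (\<lambda>i. on_arr F (\<pi> i))"
      using Y by (simp add: is_product_def)
    then show ?thesis by blast
  qed
  moreover have "\<exists>E P p q ev. is_exponential D (on_ob F A) (on_ob F B) E P p q ev"
    if "A \<in> Ob C" "B \<in> Ob C" for A B
    using cc that is_exponential_image[OF that] unfolding cartesian_closed_def by meson
  ultimately show ?thesis
    by (simp add: cartesian_closed_def has_finite_products_def Ball_Ob_iff D.category_axioms)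
qed

end

section \<open>Slices over a terminal object and iterated slices\<close>

text \<open>Every object has exactly one arrow to \<open>T\<close>, so an object of the slice is
  determined by its domain, and every arrow of \<open>C\<close> commutes with the structure arrows
  to \<open>T\<close>.\<close>

lemma (in category) slice_terminal_iso:
  assumes T: "is_terminal C T"
  shows "category_iso (slice C T) C \<lparr>on_ob = Dom C, on_arr = (\<lambda>(p, f, q). f)\<rparr>"
proof
  have eq: "p = q" if "p \<in> Arr C" "q \<in> Arr C" "Cod C p = T" "Cod C q = T" "Dom C p = Dom C q" for p q
    using T that unfolding is_terminal_def in_Hom_iff by (metis Dom_in_Ob)
  have ex: "\<exists>p\<in>Arr C. Dom C p = X \<and> Cod C p = T" if "X \<in> Ob C" for X
    using T that by (auto simp: is_terminal_def in_Hom_iff)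
  show "is_functor (slice C T) C \<lparr>on_ob = Dom C, on_arr = (\<lambda>(p, f, q). f)\<rparr>"
    by (auto simp: is_functor_def category_slice category_axioms in_Hom_iff)
  show "bij_betw (on_ob \<lparr>on_ob = Dom C, on_arr = \<lambda>(p, f, q). f\<rparr>) (Ob (slice C T)) (Ob C)"
    unfolding bij_betw_def
  proof (intro conjI set_eqI iffI)
    fix X assume "X \<in> Ob C"
    then obtain p where "p \<in> Arr C" "Dom C p = X" "Cod C p = T"
      using ex by blast
    then show "X \<in> on_ob \<lparr>on_ob = Dom C, on_arr = \<lambda>(p, f, q). f\<rparr> ` Ob (slice C T)"
      by (intro rev_image_eqI[of p]) simp_all
  qed (auto intro!: inj_onI eq)
  show "bij_betw (on_arr \<lparr>on_ob = Dom C, on_arr = \<lambda>(p, f, q). f\<rparr>) (Arr (slice C T)) (Arr C)"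
    unfolding bij_betw_def
  proof (intro conjI set_eqI iffI)
    show "inj_on (on_arr \<lparr>on_ob = Dom C, on_arr = \<lambda>(p, f, q). f\<rparr>) (Arr (slice C T))"
      by (rule inj_onI) (auto intro!: eq)
  next
    fix f assume f: "f \<in> Arr C"
    obtain p q where "p \<in> Arr C" "Dom C p = Dom C f" "Cod C p = T"
      and "q \<in> Arr C" "Dom C q = Cod C f" "Cod C q = T"
      using ex f by (meson Dom_in_Ob Cod_in_Ob)
    then have "(p, f, q) \<in> Arr (slice C T)"
      using f by (auto intro: eq)
    then show "f \<in> on_arr \<lparr>on_ob = Dom C, on_arr = \<lambda>(p, f, q). f\<rparr> ` Arr (slice C T)"
      by (rule rev_image_eqI) simp
  qed auto
qed

text \<open>An object \<open>(a, r, a')\<close> of the slice over \<open>p\<close> has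
  \<open>a' = p\<close> and \<open>a = p \<cdot> r\<close>, so \<open>r\<close> alone carries
  information. In the same way an arrow, which is a triple of triples, is determined by its central
  component and the two arrows \<open>r\<close> and \<open>s\<close>.\<close>

lemma (in category) slice_slice_iso:
  assumes p: "p \<in> Ob (slice C I)"
  shows "category_iso (slice C (Dom C p)) (slice (slice C I) p)
    \<lparr>on_ob = (\<lambda>r. (p \<cdot> r, r, p)),
     on_arr = (\<lambda>(r, f, s). ((p \<cdot> r, r, p), (p \<cdot> r, f, p \<cdot> s), (p \<cdot> s, s, p)))\<rparr>"
proof
  interpret S: category "slice C I" by (rule category_slice)
  let ?F = "\<lparr>on_ob = (\<lambda>r. (p \<cdot> r, r, p)),
     on_arr = (\<lambda>(r, f, s). ((p \<cdot> r, r, p), (p \<cdot> r, f, p \<cdot> s), (p \<cdot> s, s, p)))\<rparr>"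
  show "is_functor (slice C (Dom C p)) (slice (slice C I) p) ?F"
    using p by (auto simp: is_functor_def category_slice S.category_slice in_Hom_iff)
  show "bij_betw (on_ob ?F) (Ob (slice C (Dom C p))) (Ob (slice (slice C I) p))"
    unfolding bij_betw_def using p by (force simp: inj_on_def image_iff)
  show "bij_betw (on_arr ?F) (Arr (slice C (Dom C p))) (Arr (slice (slice C I) p))"
    unfolding bij_betw_def
  proof (intro conjI set_eqI iffI)
    show "inj_on (on_arr ?F) (Arr (slice C (Dom C p)))"
      by (auto simp: inj_on_def)
  next
    fix z assume "z \<in> on_arr ?F ` Arr (slice C (Dom C p))"
    then obtain y where y: "z = on_arr ?F y" "y \<in> Arr (slice C (Dom C p))"
      by blast
    obtain r f s where "y = (r, f, s)"
      by (rule prod_cases3)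
    with y p show "z \<in> Arr (slice (slice C I) p)"
      by simp
  next
    fix z assume z: "z \<in> Arr (slice (slice C I) p)"
    obtain a r a' b f b' c s c' where zeq: "z = ((a, r, a'), (b, f, b'), (c, s, c'))"
      by (metis prod_cases3)
    have "z = ((p \<cdot> r, r, p), (p \<cdot> r, f, p \<cdot> s), (p \<cdot> s, s, p))"
      and "(r, f, s) \<in> Arr (slice C (Dom C p))"
      using z unfolding zeq by (simp; elim conjE; simp)+
    then show "z \<in> on_arr ?F ` Arr (slice C (Dom C p))"
      by (intro rev_image_eqI[of "(r, f, s)"]) simp_all
  qed
qed

lemma locally_cartesian_closed_slice:
  assumes C: "locally_cartesian_closed C"
  shows "locally_cartesian_closed (slice C I)"
proof -
  interpret category C using C by (simp add: locally_cartesian_closed_def)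
  have "cartesian_closed (slice (slice C I) p)" if p: "p \<in> Ob (slice C I)" for p
  proof -
    have "cartesian_closed (slice C (Dom C p))"
      using C p by (simp add: locally_cartesian_closed_def)
    then show ?thesis
      by (rule category_iso.cartesian_closed_image[OF slice_slice_iso[OF p]])
  qed
  then show ?thesis
    by (simp add: locally_cartesian_closed_def category_slice)
qed


section \<open>Limits in slices\<close>

lemma is_functorD:
  assumes "is_functor C D F"
  shows "X \<in> Ob C \<Longrightarrow> on_ob F X \<in> Ob D"
    "f \<in> Arr C \<Longrightarrow> on_arr F f \<in> Arr D"
    "f \<in> Arr C \<Longrightarrow> Dom D (on_arr F f) = on_ob F (Dom C f)"
    "f \<in> Arr C \<Longrightarrow> Cod D (on_arr F f) = on_ob F (Cod C f)"
    "X \<in> Ob C \<Longrightarrow> on_arr F (Id C X) = Id D (on_ob F X)"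
    "f \<in> Arr C \<Longrightarrow> g \<in> Arr C \<Longrightarrow> Dom C g = Cod C f \<Longrightarrow>
      on_arr F (g \<cdot>\<^bsub>C\<^esub> f) = on_arr F g \<cdot>\<^bsub>D\<^esub> on_arr F f"
    "category C" "category D"
  using assms by (simp_all add: is_functor_def in_Hom_iff)

lemma is_functor_comp:
  assumes F: "is_functor C D F" and G: "is_functor D E G"
  shows "is_functor C E (comp_func G F)"
  unfolding is_functor_def comp_func_def
  using is_functorD[OF F] is_functorD[OF G] by (simp add: in_Hom_iff)

text \<open>Diagrams and legs are total functions. Two descriptions of the same diagram may differ
  outside \<open>J\<close>, so they are compared on \<open>J\<close> only.\<close>

lemma is_limit_cong:
  assumes J: "category J"
    and ob: "\<And>j. j \<in> Ob J \<Longrightarrow> on_ob D j = on_ob D' j"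
    and arr: "\<And>u. u \<in> Arr J \<Longrightarrow> on_arr D u = on_arr D' u"
    and leg: "\<And>j. j \<in> Ob J \<Longrightarrow> \<pi> j = \<pi>' j"
  shows "is_limit J C D L \<pi> \<longleftrightarrow> is_limit J C D' L \<pi>'"
proof -
  interpret J: category J by (rule J)
  have "is_cone J C D M \<mu> \<longleftrightarrow> is_cone J C D' M \<mu>" for M \<mu>
    using ob arr by (simp add: is_cone_def)
  moreover have "is_cone J C D' L \<pi> \<longleftrightarrow> is_cone J C D' L \<pi>'"
    using leg by (simp add: is_cone_def)
  ultimately show ?thesis
    using leg by (simp add: is_limit_def)
qed

text \<open>A terminal object \<open>0\<close> is adjoined to \<open>J\<close>. The object \<open>j\<close> and the arrow \<open>u\<close> of \<open>J\<close> become
  \<open>Suc j\<close> and \<open>old_arr u\<close>, and \<open>top_arr m\<close> is the arrow from \<open>m\<close> to \<open>0\<close>.\<close>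

definition old_arr :: "nat \<Rightarrow> nat" where "old_arr u = 2 * u"

definition top_arr :: "nat \<Rightarrow> nat" where "top_arr m = Suc (2 * m)"

lemma old_top_arr [simp]:
  "even (old_arr u)" "old_arr u div 2 = u" "odd (top_arr m)" "top_arr m div 2 = m"
  "old_arr u = old_arr v \<longleftrightarrow> u = v" "top_arr m = top_arr n \<longleftrightarrow> m = n"
  "old_arr u \<noteq> top_arr m" "top_arr m \<noteq> old_arr u"
  by (simp_all add: old_arr_def top_arr_def) presburger+

text \<open>Parity separates the two kinds of arrows and keeps the shape on \<open>nat\<close>. An
  arrow to \<open>0\<close> is determined by its domain, so a composite whose left factor is odd
  needs only the domain of the right factor; \<open>top_arr 0\<close> is the identity of
  \<open>0\<close>.\<close>

definition with_terminal :: "(nat, nat) cat \<Rightarrow> (nat, nat) cat" where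
  "with_terminal J =
     \<lparr>Ob = insert 0 (Suc ` Ob J),
      Arr = old_arr ` Arr J \<union> top_arr ` insert 0 (Suc ` Ob J),
      Dom = (\<lambda>a. if even a then Suc (Dom J (a div 2)) else a div 2),
      Cod = (\<lambda>a. if even a then Suc (Cod J (a div 2)) else 0),
      Id = case_nat (top_arr 0) (\<lambda>j. old_arr (Id J j)),
      Cmp = (\<lambda>b a. if even b then old_arr (Cmp J (b div 2) (a div 2))
        else top_arr (if even a then Suc (Dom J (a div 2)) else a div 2))\<rparr>"

lemma with_terminal_simps [simp]:
  "Ob (with_terminal J) = insert 0 (Suc ` Ob J)"
  "Dom (with_terminal J) (old_arr u) = Suc (Dom J u)"
  "Dom (with_terminal J) (top_arr m) = m"
  "Cod (with_terminal J) (old_arr u) = Suc (Cod J u)"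
  "Cod (with_terminal J) (top_arr m) = 0"
  "Id (with_terminal J) 0 = top_arr 0"
  "Id (with_terminal J) (Suc j) = old_arr (Id J j)"
  "old_arr v \<cdot>\<^bsub>with_terminal J\<^esub> old_arr u = old_arr (v \<cdot>\<^bsub>J\<^esub> u)"
  "top_arr m \<cdot>\<^bsub>with_terminal J\<^esub> old_arr u = top_arr (Suc (Dom J u))"
  "top_arr m \<cdot>\<^bsub>with_terminal J\<^esub> top_arr k = top_arr k"
  by (simp_all add: with_terminal_def)

lemma Arr_with_terminal:
  "Arr (with_terminal J) = old_arr ` Arr J \<union> top_arr ` insert 0 (Suc ` Ob J)"
  by (simp add: with_terminal_def)

lemma Arr_with_terminal_simps [simp]:
  "old_arr u \<in> Arr (with_terminal J) \<longleftrightarrow> u \<in> Arr J"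
  "top_arr m \<in> Arr (with_terminal J) \<longleftrightarrow> m = 0 \<or> m \<in> Suc ` Ob J"
  by (auto simp: Arr_with_terminal)

lemma Ball_Arr_with_terminal:
  "(\<forall>a \<in> Arr (with_terminal J). P a) \<longleftrightarrow>
     (\<forall>u\<in>Arr J. P (old_arr u)) \<and> P (top_arr 0) \<and> (\<forall>j\<in>Ob J. P (top_arr (Suc j)))"
  by (auto simp: Arr_with_terminal)

lemma category_with_terminal:
  assumes "category J"
  shows "category (with_terminal J)"
proof -
  interpret J: category J by (rule assms)
  let ?J = "with_terminal J"
  have arr: "(\<exists>u\<in>Arr J. a = old_arr u) \<or> (\<exists>m\<in>Ob ?J. a = top_arr m)" if "a \<in> Arr ?J" for a
    using that by (auto simp: Arr_with_terminal)
  show ?thesis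
  proof
    fix f assume "f \<in> Arr ?J"
    then show "Dom ?J f \<in> Ob ?J" "Cod ?J f \<in> Ob ?J"
      using arr[of f] by auto
  next
    fix X assume "X \<in> Ob ?J"
    then show "Id ?J X \<in> Hom ?J X X"
      by (auto simp: in_Hom_iff)
  next
    fix f g X Y Z assume "f \<in> Hom ?J X Y" "g \<in> Hom ?J Y Z"
    then show "g \<cdot>\<^bsub>?J\<^esub> f \<in> Hom ?J X Z"
      using arr[of f] arr[of g] by (auto simp: in_Hom_iff)
  next
    fix f X Y assume "f \<in> Hom ?J X Y"
    then show "Id ?J Y \<cdot>\<^bsub>?J\<^esub> f = f" "f \<cdot>\<^bsub>?J\<^esub> Id ?J X = f"
      using arr[of f] by (auto simp: in_Hom_iff)
  next
    fix f g h W X Y Z assume "f \<in> Hom ?J W X" "g \<in> Hom ?J X Y" "h \<in> Hom ?J Y Z"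
    then show "(h \<cdot>\<^bsub>?J\<^esub> g) \<cdot>\<^bsub>?J\<^esub> f = h \<cdot>\<^bsub>?J\<^esub> (g \<cdot>\<^bsub>?J\<^esub> f)"
      using arr[of f] arr[of g] arr[of h] by (auto simp: in_Hom_iff)
  qed
qed

section \<open>Diagrams and limits of a slice, expressed in the base\<close>

text \<open>An object of the slice is itself an arrow into \<open>I\<close>, so
  \<open>on_ob D j\<close> serves as the value at the arrow from \<open>Suc j\<close> to the new
  vertex, which is sent to \<open>I\<close>.\<close>

definition slice_diagram ::
  "('o, 'a) cat \<Rightarrow> 'o \<Rightarrow> (nat, nat, 'a, 'a \<times> 'a \<times> 'a) func \<Rightarrow> (nat, nat, 'o, 'a) func" where
  "slice_diagram C I D =
     \<lparr>on_ob = case_nat I (\<lambda>j. Dom C (on_ob D j)),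
      on_arr = (\<lambda>a. if even a then fst (snd (on_arr D (a div 2)))
        else case_nat (Id C I) (on_ob D) (a div 2))\<rparr>"

lemma slice_diagram_simps [simp]:
  "on_ob (slice_diagram C I D) 0 = I"
  "on_ob (slice_diagram C I D) (Suc j) = Dom C (on_ob D j)"
  "on_arr (slice_diagram C I D) (old_arr u) = fst (snd (on_arr D u))"
  "on_arr (slice_diagram C I D) (top_arr m) = case_nat (Id C I) (on_ob D) m"
  by (simp_all add: slice_diagram_def)

lemma functor_to_slice_arr:
  assumes "is_functor J (slice C I) D" "u \<in> Arr J"
  obtains d where "on_arr D u = (on_ob D (Dom J u), d, on_ob D (Cod J u))"
    "d \<in> Arr C" "Dom C d = Dom C (on_ob D (Dom J u))" "Cod C d = Dom C (on_ob D (Cod J u))"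
    "on_ob D (Cod J u) \<cdot>\<^bsub>C\<^esub> d = on_ob D (Dom J u)"
proof -
  have "on_arr D u \<in> Hom (slice C I) (on_ob D (Dom J u)) (on_ob D (Cod J u))"
    using assms by (simp add: is_functor_def)
  then show thesis
    by (rule Hom_sliceE) (rule that)
qed

lemma is_functor_slice_diagram:
  assumes D: "is_functor J (slice C I) D" and C: "category C" and I: "I \<in> Ob C"
  shows "is_functor (with_terminal J) C (slice_diagram C I D)"
proof -
  interpret C: category C by (rule C)
  interpret J: category J using D by (simp add: is_functor_def)
  note FD = is_functorD[OF D]
  have ob: "on_ob D j \<in> Arr C" "Cod C (on_ob D j) = I" if "j \<in> Ob J" for j
    using FD(1)[OF that] by simp_all
  have comp: "fst (snd (on_arr D (v \<cdot>\<^bsub>J\<^esub> u))) = fst (snd (on_arr D v)) \<cdot>\<^bsub>C\<^esub> fst (snd (on_arr D u))"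
    if uv: "u \<in> Arr J" "v \<in> Arr J" "Dom J v = Cod J u" for u v
  proof -
    obtain d where "on_arr D u = (on_ob D (Dom J u), d, on_ob D (Cod J u))"
      by (rule functor_to_slice_arr[OF D uv(1)])
    moreover obtain e where "on_arr D v = (on_ob D (Dom J v), e, on_ob D (Cod J v))"
      by (rule functor_to_slice_arr[OF D uv(2)])
    ultimately show ?thesis
      using FD(6)[OF uv] by simp
  qed
  have mid: "fst (snd (on_arr D u)) \<in> Hom C (Dom C (on_ob D (Dom J u))) (Dom C (on_ob D (Cod J u))) \<and>
      on_ob D (Cod J u) \<cdot>\<^bsub>C\<^esub> fst (snd (on_arr D u)) = on_ob D (Dom J u)"
    if "u \<in> Arr J" for u
    by (rule functor_to_slice_arr[OF D that]) (simp add: in_Hom_iff)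
  show ?thesis
    unfolding is_functor_def Ball_Arr_with_terminal
    using C category_with_terminal[OF J.category_axioms] I ob comp mid FD(5)
    by (auto simp: in_Hom_iff)
qed

text \<open>The leg at \<open>0\<close> makes the vertex an object over \<open>I\<close>. The cone
  equations at the arrows \<open>top_arr (Suc j)\<close> say that the remaining legs are arrows over
  \<open>I\<close>.\<close>

lemma is_cone_slice_diagram_iff:
  assumes D: "is_functor J (slice C I) D" and C: "category C" and I: "I \<in> Ob C"
  shows "is_cone (with_terminal J) C (slice_diagram C I D) M \<mu> \<longleftrightarrow>
    Dom C (\<mu> 0) = M \<and> is_cone J (slice C I) D (\<mu> 0) (\<lambda>j. (\<mu> 0, \<mu> (Suc j), on_ob D j))"
proof -
  interpret C: category C by (rule C)
  interpret J: category J using D by (simp add: is_functor_def)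
  have ob: "on_ob D j \<in> Arr C" "Cod C (on_ob D j) = I" if "j \<in> Ob J" for j
    using is_functorD(1)[OF D that] by simp_all
  have arr: "on_arr D u \<cdot>\<^bsub>slice C I\<^esub> (\<mu> 0, \<mu> (Suc (Dom J u)), on_ob D (Dom J u)) =
        (\<mu> 0, \<mu> (Suc (Cod J u)), on_ob D (Cod J u)) \<longleftrightarrow>
      fst (snd (on_arr D u)) \<cdot>\<^bsub>C\<^esub> \<mu> (Suc (Dom J u)) = \<mu> (Suc (Cod J u))"
    if "u \<in> Arr J" for u
    by (rule functor_to_slice_arr[OF D that]) simp
  show ?thesis
    unfolding is_cone_def Ball_Arr_with_terminal
    using ob arr I by (auto simp: in_Hom_iff)
qed

text \<open>Moves unique existence between arrows of a slice, which are triples with prescribed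
  ends, and their middle components in the base.\<close>

lemma Ex1_reindex:
  assumes "inj g" and iff: "\<And>h. P (g h) \<longleftrightarrow> Q h" and "\<And>k. P k \<Longrightarrow> \<exists>h. k = g h"
  shows "(\<exists>!k. P k) \<longleftrightarrow> (\<exists>!h. Q h)"
  unfolding iff[symmetric] using assms(1,3) unfolding Ex1_def inj_def by metis

text \<open>Cones correspond, and so do their fillers: the condition at the leg \<open>0\<close> is
  \<open>p \<cdot> h = \<mu> 0\<close>, which is exactly what makes \<open>h\<close> an arrow over
  \<open>I\<close>.\<close>

lemma is_limit_slice_iff:
  assumes D: "is_functor J (slice C I) D" and C: "category C" and I: "I \<in> Ob C"
    and \<pi>: "\<And>j. j \<in> Ob J \<Longrightarrow> \<pi> j \<in> Hom (slice C I) p (on_ob D j)" and p: "p \<in> Ob (slice C I)"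
  shows "is_limit J (slice C I) D p \<pi> \<longleftrightarrow>
    is_limit (with_terminal J) C (slice_diagram C I D) (Dom C p) (case_nat p (\<lambda>j. fst (snd (\<pi> j))))"
    (is "_ \<longleftrightarrow> is_limit ?J C ?D _ ?\<pi>")
proof -
  interpret C: category C by (rule C)
  interpret J: category J using D by (simp add: is_functor_def)
  have ob: "on_ob D j \<in> Arr C" "Cod C (on_ob D j) = I" if "j \<in> Ob J" for j
    using is_functorD(1)[OF D that] by simp_all
  have \<pi>': "\<pi> j = (p, fst (snd (\<pi> j)), on_ob D j)" if "j \<in> Ob J" for j
    using \<pi>[OF that] by (rule Hom_slice_shape)
  have cong: "is_cone J (slice C I) D q \<nu> \<longleftrightarrow> is_cone J (slice C I) D q \<nu>'"
    if "\<And>j. j \<in> Ob J \<Longrightarrow> \<nu> j = \<nu>' j" for q \<nu> \<nu>'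
    using that by (simp add: is_cone_def)
  have cone: "is_cone J (slice C I) D p \<pi> \<longleftrightarrow> is_cone ?J C ?D (Dom C p) ?\<pi>"
    unfolding is_cone_slice_diagram_iff[OF D C I] using cong[of \<pi>, OF \<pi>'] by simp
  have fill: "(\<exists>!k. k \<in> Hom (slice C I) (\<mu> 0) p \<and>
        (\<forall>j\<in>Ob J. \<pi> j \<cdot>\<^bsub>slice C I\<^esub> k = (\<mu> 0, \<mu> (Suc j), on_ob D j))) \<longleftrightarrow>
      (\<exists>!h. h \<in> Hom C M (Dom C p) \<and> (\<forall>m\<in>Ob ?J. ?\<pi> m \<cdot>\<^bsub>C\<^esub> h = \<mu> m))"
    (is "(\<exists>!k. ?P k) \<longleftrightarrow> (\<exists>!h. ?Q h)")
    if "is_cone ?J C ?D M \<mu>" for M \<mu>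
  proof -
    have \<mu>: "\<mu> 0 \<in> Arr C" "Dom C (\<mu> 0) = M" "Cod C (\<mu> 0) = I"
      using that by (auto simp: is_cone_def in_Hom_iff)
    have "\<pi> j \<cdot>\<^bsub>slice C I\<^esub> (\<mu> 0, h, p) = (\<mu> 0, \<mu> (Suc j), on_ob D j) \<longleftrightarrow>
        fst (snd (\<pi> j)) \<cdot>\<^bsub>C\<^esub> h = \<mu> (Suc j)" if "j \<in> Ob J" for j h
      by (subst \<pi>'[OF that]) simp
    then have iff: "?P (\<mu> 0, h, p) \<longleftrightarrow> ?Q h" for h
      using \<mu> p by (auto simp: in_Hom_iff)
    have shape: "\<exists>h. k = (\<mu> 0, h, p)" if "?P k" for k
      using Hom_slice_shape[OF conjunct1[OF that]] by blast
    show ?thesis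
      by (rule Ex1_reindex[of "\<lambda>h. (\<mu> 0, h, p)" ?P ?Q, OF _ iff shape]) (auto simp: inj_def)
  qed
  show ?thesis
  proof
    assume L: "is_limit J (slice C I) D p \<pi>"
    have "\<exists>!h. h \<in> Hom C M (Dom C p) \<and> (\<forall>m\<in>Ob ?J. ?\<pi> m \<cdot>\<^bsub>C\<^esub> h = \<mu> m)"
      if "is_cone ?J C ?D M \<mu>" for M \<mu>
      using L that is_cone_slice_diagram_iff[OF D C I, of M \<mu>] fill[OF that]
      unfolding is_limit_def by blast
    then show "is_limit ?J C ?D (Dom C p) ?\<pi>"
      using L cone unfolding is_limit_def by blast
  next
    assume L: "is_limit ?J C ?D (Dom C p) ?\<pi>"
    have "\<exists>!k. k \<in> Hom (slice C I) q p \<and> (\<forall>j\<in>Ob J. \<pi> j \<cdot>\<^bsub>slice C I\<^esub> k = \<nu> j)"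
      if \<nu>: "is_cone J (slice C I) D q \<nu>" for q \<nu>
    proof -
      \<comment> \<open>Taking \<open>q\<close> itself as the leg at \<open>0\<close> turns a cone
        in the slice into a cone over the extended diagram.\<close>
      let ?\<mu> = "case_nat q (\<lambda>j. fst (snd (\<nu> j)))"
      have \<nu>': "\<nu> j = (q, ?\<mu> (Suc j), on_ob D j)" if "j \<in> Ob J" for j
        using \<nu> that Hom_slice_shape[of "\<nu> j" C I q "on_ob D j"] by (simp add: is_cone_def)
      then have "is_cone ?J C ?D (Dom C q) ?\<mu>"
        unfolding is_cone_slice_diagram_iff[OF D C I]
        using cong[of \<nu> "\<lambda>j. (q, ?\<mu> (Suc j), on_ob D j)"] \<nu> by simp
      moreover from this have "\<exists>!h. h \<in> Hom C (Dom C q) (Dom C p) \<and> (\<forall>m\<in>Ob ?J. ?\<pi> m \<cdot>\<^bsub>C\<^esub> h = ?\<mu> m)"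
        using L unfolding is_limit_def by blast
      ultimately have "\<exists>!k. k \<in> Hom (slice C I) q p \<and>
          (\<forall>j\<in>Ob J. \<pi> j \<cdot>\<^bsub>slice C I\<^esub> k = (q, ?\<mu> (Suc j), on_ob D j))"
        using fill[of "Dom C q" ?\<mu>] by simp
      moreover have "(\<forall>j\<in>Ob J. \<pi> j \<cdot>\<^bsub>slice C I\<^esub> k = (q, ?\<mu> (Suc j), on_ob D j)) \<longleftrightarrow>
          (\<forall>j\<in>Ob J. \<pi> j \<cdot>\<^bsub>slice C I\<^esub> k = \<nu> j)" for k
        by (rule ball_cong[OF refl]) (simp only: \<nu>'[symmetric])
      ultimately show ?thesis
        by (simp only:)
    qed
    then show "is_limit J (slice C I) D p \<pi>"
      using L cone unfolding is_limit_def by blast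
  qed
qed

section \<open>Functors applied to arrows into a fixed object\<close>

lemma is_functor_slice_map:
  assumes F: "is_functor C D F"
  shows "is_functor (slice C I) (slice D (on_ob F I)) (slice_map F)"
proof -
  interpret C: category C by (rule is_functorD(7)[OF F])
  interpret D: category D by (rule is_functorD(8)[OF F])
  note FD = is_functorD(2-6)[OF F]
  have "on_arr F q \<cdot>\<^bsub>D\<^esub> on_arr F f = on_arr F p" if "(p, f, q) \<in> Arr (slice C I)" for p f q
    using that FD(5)[of f q] by simp
  then show ?thesis
    unfolding is_functor_def slice_map_def
    using FD C.category_slice D.category_slice by (auto simp: in_Hom_iff)
qed

text \<open>The extended shape is still finite, so \<open>F\<close> preserves the limit of the
  extended diagram. Its image agrees on the shape with the extension of the image diagram, and
  \<open>is_limit_slice_iff\<close> translates the result back.\<close>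

lemma slice_map_preserves_finite_limits:
  assumes F: "is_functor C D F" and pres: "preserves_finite_limits C D F" and I: "I \<in> Ob C"
  shows "preserves_finite_limits (slice C I) (slice D (on_ob F I)) (slice_map F)"
  unfolding preserves_finite_limits_def
proof (intro allI impI)
  fix J :: "(nat, nat) cat" and G p \<pi>
  assume J: "category J" "finite (Ob J)" "finite (Arr J)" and G: "is_functor J (slice C I) G"
    and L: "is_limit J (slice C I) G p \<pi>"
  interpret J: category J by (rule J)
  interpret C: category C by (rule is_functorD(7)[OF F])
  interpret D: category D by (rule is_functorD(8)[OF F])
  note FS = is_functor_slice_map[OF F, of I]
  let ?J = "with_terminal J" and ?F = "slice_map F"
  have p: "p \<in> Ob (slice C I)" and \<pi>: "\<And>j. j \<in> Ob J \<Longrightarrow> \<pi> j \<in> Hom (slice C I) p (on_ob G j)"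
    using L by (simp_all add: is_limit_def is_cone_def)
  have J': "category ?J" "finite (Ob ?J)" "finite (Arr ?J)"
    using J by (simp_all add: category_with_terminal Arr_with_terminal)
  have "is_limit ?J C (slice_diagram C I G) (Dom C p) (case_nat p (\<lambda>j. fst (snd (\<pi> j))))"
    using L is_limit_slice_iff[OF G C.category_axioms I \<pi> p] by simp
  then have "is_limit ?J D (comp_func F (slice_diagram C I G)) (on_ob F (Dom C p))
      (\<lambda>m. on_arr F (case_nat p (\<lambda>j. fst (snd (\<pi> j))) m))"
    using pres J' is_functor_slice_diagram[OF G C.category_axioms I]
    unfolding preserves_finite_limits_def by blast
  moreover have "is_limit ?J D (comp_func F (slice_diagram C I G)) (on_ob F (Dom C p))
      (\<lambda>m. on_arr F (case_nat p (\<lambda>j. fst (snd (\<pi> j))) m)) \<longleftrightarrow>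
    is_limit ?J D (slice_diagram D (on_ob F I) (comp_func ?F G)) (Dom D (on_ob ?F p))
      (case_nat (on_ob ?F p) (\<lambda>j. fst (snd (on_arr ?F (\<pi> j)))))"
  proof -
    have ob: "on_ob F (Dom C (on_ob G j)) = Dom D (on_arr F (on_ob G j))" if "j \<in> Ob J" for j
      using is_functorD(1)[OF G that] is_functorD(3)[OF F] by simp
    have mid: "fst (snd (on_arr ?F a)) = on_arr F (fst (snd a))" for a
      by (simp add: slice_map_def split: prod.split)
    have dom: "on_ob F (Dom C p) = Dom D (on_ob ?F p)"
      using p is_functorD(3)[OF F] by (simp add: slice_map_def)
    show ?thesis
      unfolding dom
    proof (rule is_limit_cong[OF J'(1)])
      fix m assume "m \<in> Ob ?J"
      then show "on_ob (comp_func F (slice_diagram C I G)) m =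
          on_ob (slice_diagram D (on_ob F I) (comp_func ?F G)) m"
        using ob by (auto simp: comp_func_def slice_map_def)
    next
      \<comment> \<open>At \<open>top_arr 0\<close> the agreement is the preservation of
        \<open>Id C I\<close> by \<open>F\<close>; at the other arrows it holds by
        unfolding.\<close>
      fix u assume "u \<in> Arr ?J"
      then show "on_arr (comp_func F (slice_diagram C I G)) u =
          on_arr (slice_diagram D (on_ob F I) (comp_func ?F G)) u"
        using is_functorD(5)[OF F I]
        by (auto simp: Arr_with_terminal comp_func_def slice_map_def split: prod.split)
    next
      fix m
      show "on_arr F (case_nat p (\<lambda>j. fst (snd (\<pi> j))) m) =
          case_nat (on_ob ?F p) (\<lambda>j. fst (snd (on_arr ?F (\<pi> j)))) m"
        using mid by (simp add: slice_map_def split: nat.split)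
    qed
  qed
  ultimately have L': "is_limit ?J D (slice_diagram D (on_ob F I) (comp_func ?F G)) (Dom D (on_ob ?F p))
      (case_nat (on_ob ?F p) (\<lambda>j. fst (snd (on_arr ?F (\<pi> j)))))"
    by simp
  have "on_arr ?F (\<pi> j) \<in> Hom (slice D (on_ob F I)) (on_ob ?F p) (on_ob (comp_func ?F G) j)"
    if "j \<in> Ob J" for j
    using \<pi>[OF that] is_functorD(2-4)[OF FS] by (simp add: in_Hom_iff comp_func_def)
  moreover have "on_ob ?F p \<in> Ob (slice D (on_ob F I))"
    using is_functorD(1)[OF FS p] .
  ultimately show "is_limit J (slice D (on_ob F I)) (comp_func ?F G) (on_ob ?F p) (\<lambda>j. on_arr ?F (\<pi> j))"
    using L' is_limit_slice_iff[OF is_functor_comp[OF G FS] D.category_axioms is_functorD(1)[OF F I],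
        of "\<lambda>j. on_arr ?F (\<pi> j)" "on_ob ?F p"] by simp
qed


section \<open>Pulling back preserves limits\<close>

lemma is_cone_functor:
  assumes F: "is_functor C D F" and G: "is_functor J C G" and L: "is_cone J C G L \<pi>"
  shows "is_cone J D (comp_func F G) (on_ob F L) (\<lambda>j. on_arr F (\<pi> j))"
proof -
  interpret J: category J by (rule is_functorD(7)[OF G])
  have \<pi>: "L \<in> Ob C" "\<And>j. j \<in> Ob J \<Longrightarrow> \<pi> j \<in> Hom C L (on_ob G j)"
    "\<And>u. u \<in> Arr J \<Longrightarrow> on_arr G u \<cdot>\<^bsub>C\<^esub> \<pi> (Dom J u) = \<pi> (Cod J u)"
    using L by (simp_all add: is_cone_def)
  have "on_arr F (on_arr G u) \<cdot>\<^bsub>D\<^esub> on_arr F (\<pi> (Dom J u)) = on_arr F (\<pi> (Cod J u))"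
    if "u \<in> Arr J" for u
    using is_functorD(6)[OF F, of "\<pi> (Dom J u)" "on_arr G u"] \<pi>(2)[of "Dom J u"] \<pi>(3)[OF that]
      is_functorD(2,3)[OF G that] that by (simp add: in_Hom_iff)
  then show ?thesis
    using \<pi> is_functorD(1-4)[OF F] by (simp add: is_cone_def comp_func_def in_Hom_iff)
qed

locale pullback_along = category C for C :: "('o, 'a) cat" (structure) +
  fixes u :: 'a and pb :: "'a \<Rightarrow> 'a \<times> 'a"
  assumes u: "u \<in> Arr C" and pb: "pullback_choice C u pb"
begin

lemma is_pullback_pb:
  assumes "q \<in> Ob (slice C (Cod C u))"
  shows "is_pullback C u q (fst (pb q)) (snd (pb q))"
  using pb assms by (simp add: pullback_choice_def)

lemma pb_simps [simp]:
  assumes "q \<in> Arr C" "Cod C q = Cod C u"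
  shows "fst (pb q) \<in> Arr C" "snd (pb q) \<in> Arr C" "Cod C (fst (pb q)) = Dom C u"
    "Cod C (snd (pb q)) = Dom C q" "Dom C (snd (pb q)) = Dom C (fst (pb q))"
    "q \<cdot> snd (pb q) = u \<cdot> fst (pb q)"
  using is_pullback_pb[of q] assms by (simp_all add: is_pullback_def)

lemma pb_eqI:
  assumes "q \<in> Arr C" "Cod C q = Cod C u" "h \<in> Hom C Z (Dom C (fst (pb q)))"
    "h' \<in> Hom C Z (Dom C (fst (pb q)))"
    "fst (pb q) \<cdot> h = fst (pb q) \<cdot> h'" "snd (pb q) \<cdot> h = snd (pb q) \<cdot> h'"
  shows "h = h'"
  by (rule pullback_eqI[OF is_pullback_pb[of q]]) (use assms in simp_all)

lemma pb_lift:
  assumes q: "q \<in> Arr C" "Cod C q = Cod C u"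
    and m: "m \<in> Arr C" "Cod C m = Dom C u" and k: "k \<in> Arr C" "Cod C k = Dom C q" "Dom C k = Dom C m"
    and eq: "q \<cdot> k = u \<cdot> m"
  shows "\<exists>!h. h \<in> Hom C (Dom C m) (Dom C (fst (pb q))) \<and> fst (pb q) \<cdot> h = m \<and> snd (pb q) \<cdot> h = k"
  by (rule pullback_ex1[OF is_pullback_pb[of q]]) (use assms in \<open>simp_all add: in_Hom_iff\<close>)

text \<open>Unfolds the definite description in \<open>pullback_map\<close> once and for all:
  \<open>f \<cdot> snd (pb q)\<close> and \<open>fst (pb q)\<close> are compatible because
  \<open>r \<cdot> f = q\<close>, so the arrow described exists uniquely.\<close>

lemma pb_arr:
  assumes "(q, f, r) \<in> Arr (slice C (Cod C u))"
  obtains h where "on_arr (pullback_map C pb) (q, f, r) = (fst (pb q), h, fst (pb r))"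
    "h \<in> Arr C" "Dom C h = Dom C (fst (pb q))" "Cod C h = Dom C (fst (pb r))"
    "fst (pb r) \<cdot> h = fst (pb q)" "snd (pb r) \<cdot> h = f \<cdot> snd (pb q)"
proof -
  have eq: "r \<cdot> (f \<cdot> snd (pb q)) = u \<cdot> fst (pb q)"
    using assms Cmp_reassoc[of r f q "snd (pb q)"] by simp
  let ?P = "\<lambda>h. h \<in> Hom C (Dom C (fst (pb q))) (Dom C (fst (pb r))) \<and>
      fst (pb r) \<cdot> h = fst (pb q) \<and> snd (pb r) \<cdot> h = f \<cdot> snd (pb q)"
  define h where "h = The ?P"
  have "\<exists>!h. ?P h"
    using assms u eq by (intro pb_lift) simp_all
  from theI'[OF this] have "?P h"
    by (simp add: h_def)
  then show thesis
    by (intro that[of h]) (simp_all add: pullback_map_def h_def in_Hom_iff)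
qed

lemma is_functor_pullback_map:
  "is_functor (slice C (Cod C u)) (slice C (Dom C u)) (pullback_map C pb)"
proof -
  let ?K = "slice C (Cod C u)" and ?I = "slice C (Dom C u)" and ?P = "pullback_map C pb"
  have hom: "on_arr ?P a \<in> Hom ?I (on_ob ?P (Dom ?K a)) (on_ob ?P (Cod ?K a))" if "a \<in> Arr ?K" for a
  proof -
    obtain q f r where a: "a = (q, f, r)" by (rule prod_cases3)
    show ?thesis
      using that unfolding a by (rule pb_arr) (use that a in \<open>simp add: in_Hom_iff pullback_map_def\<close>)
  qed
  have id: "on_arr ?P (Id ?K q) = Id ?I (on_ob ?P q)" if "q \<in> Ob ?K" for q
  proof -
    have q: "q \<in> Arr C" "Cod C q = Cod C u" using that by simp_all
    then have "(q, Id C (Dom C q), q) \<in> Arr ?K" by simp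
    then obtain h where h: "on_arr ?P (q, Id C (Dom C q), q) = (fst (pb q), h, fst (pb q))"
      "h \<in> Arr C" "Dom C h = Dom C (fst (pb q))" "Cod C h = Dom C (fst (pb q))"
      "fst (pb q) \<cdot> h = fst (pb q)" "snd (pb q) \<cdot> h = Id C (Dom C q) \<cdot> snd (pb q)"
      by (rule pb_arr)
    have "h = Id C (Dom C (fst (pb q)))"
      by (rule pb_eqI[OF q, of _ "Dom C (fst (pb q))"]) (use q h in \<open>simp_all add: in_Hom_iff\<close>)
    then show ?thesis
      using h(1) by (simp add: pullback_map_def)
  qed
  have comp: "on_arr ?P (b \<cdot>\<^bsub>?K\<^esub> a) = on_arr ?P b \<cdot>\<^bsub>?I\<^esub> on_arr ?P a"
    if a: "a \<in> Arr ?K" and b: "b \<in> Arr ?K" and ba: "Dom ?K b = Cod ?K a" for a b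
  proof -
    obtain q f r where aeq: "a = (q, f, r)" by (rule prod_cases3)
    obtain r' g t where beq: "b = (r', g, t)" by (rule prod_cases3)
    have [simp]: "r' = r" using ba aeq beq by simp
    interpret K: category ?K by (rule category_slice)
    have "b \<cdot>\<^bsub>?K\<^esub> a \<in> Arr ?K"
      using a b ba by simp
    then have ab: "(q, g \<cdot> f, t) \<in> Arr ?K"
      unfolding aeq beq by (simp only: slice_simps)
    obtain h where h: "on_arr ?P (q, f, r) = (fst (pb q), h, fst (pb r))"
      "h \<in> Arr C" "Dom C h = Dom C (fst (pb q))" "Cod C h = Dom C (fst (pb r))"
      "fst (pb r) \<cdot> h = fst (pb q)" "snd (pb r) \<cdot> h = f \<cdot> snd (pb q)"
      using a unfolding aeq by (rule pb_arr)
    have b': "(r, g, t) \<in> Arr ?K" using b beq by simp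
    obtain k where k: "on_arr ?P (r, g, t) = (fst (pb r), k, fst (pb t))"
      "k \<in> Arr C" "Dom C k = Dom C (fst (pb r))" "Cod C k = Dom C (fst (pb t))"
      "fst (pb t) \<cdot> k = fst (pb r)" "snd (pb t) \<cdot> k = g \<cdot> snd (pb r)"
      using b' by (rule pb_arr)
    obtain l where l: "on_arr ?P (q, g \<cdot> f, t) = (fst (pb q), l, fst (pb t))"
      "l \<in> Arr C" "Dom C l = Dom C (fst (pb q))" "Cod C l = Dom C (fst (pb t))"
      "fst (pb t) \<cdot> l = fst (pb q)" "snd (pb t) \<cdot> l = (g \<cdot> f) \<cdot> snd (pb q)"
      using ab by (rule pb_arr)
    have a': "q \<in> Arr C" "Cod C q = Cod C u" "r \<in> Arr C" "Cod C r = Cod C u" "f \<in> Arr C"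
      "Dom C f = Dom C q" "Cod C f = Dom C r"
      using a aeq by simp_all
    have t: "t \<in> Arr C" "Cod C t = Cod C u" "g \<in> Arr C" "Dom C g = Dom C r" "Cod C g = Dom C t"
      using b beq by simp_all
    have "l = k \<cdot> h"
      by (rule pb_eqI[OF t(1,2), of _ "Dom C (fst (pb q))"])
        (use a' t h(2-) k(2-) l(2-) k(5)[THEN Cmp_reassoc] k(6)[THEN Cmp_reassoc]
          in \<open>simp_all add: in_Hom_iff\<close>)
    then show ?thesis
      using h(1) k(1) l(1) by (simp add: aeq beq)
  qed
  have "on_ob ?P q \<in> Ob ?I" if "q \<in> Ob ?K" for q
    using that by (simp add: pullback_map_def)
  then show ?thesis
    unfolding is_functor_def using hom id comp category_slice by blast
qed

text \<open>Arrows over \<open>Dom C u\<close> from \<open>m\<close> to the pullback of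
  \<open>q\<close> correspond to arrows over \<open>Cod C u\<close> from \<open>u \<cdot> m\<close>
  to \<open>q\<close>. A cone over the pulled back diagram is transposed to a cone over
  \<open>D\<close>, filled there, and the filler is transposed back.\<close>

lemma pullback_map_preserves_limits:
  assumes D: "is_functor J (slice C (Cod C u)) D" and L: "is_limit J (slice C (Cod C u)) D p \<pi>"
  shows "is_limit J (slice C (Dom C u)) (comp_func (pullback_map C pb) D)
    (on_ob (pullback_map C pb) p) (\<lambda>j. on_arr (pullback_map C pb) (\<pi> j))"
proof -
  let ?K = "slice C (Cod C u)" and ?I = "slice C (Dom C u)" and ?P = "pullback_map C pb"
  interpret J: category J by (rule is_functorD(7)[OF D])
  have coneL: "is_cone J ?K D p \<pi>" using L by (simp add: is_limit_def)
  then have p: "p \<in> Arr C" "Cod C p = Cod C u"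
    and \<pi>Hom: "\<And>j. j \<in> Ob J \<Longrightarrow> \<pi> j \<in> Hom ?K p (on_ob D j)"
    by (simp_all add: is_cone_def)
  have cone: "is_cone J ?I (comp_func ?P D) (on_ob ?P p) (\<lambda>j. on_arr ?P (\<pi> j))"
    by (rule is_cone_functor[OF is_functor_pullback_map D coneL])
  have D_ob: "on_ob D j \<in> Arr C" "Cod C (on_ob D j) = Cod C u" if "j \<in> Ob J" for j
    using is_functorD(1)[OF D that] by simp_all
  define c where "c j = fst (snd (\<pi> j))" for j
  have \<pi>_eq: "\<pi> j = (p, c j, on_ob D j)" if "j \<in> Ob J" for j
    using Hom_slice_shape[OF \<pi>Hom[OF that]] by (simp add: c_def)
  have c: "c j \<in> Arr C" "Dom C (c j) = Dom C p" "Cod C (c j) = Dom C (on_ob D j)"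
      "on_ob D j \<cdot> c j = p" if "j \<in> Ob J" for j
    using \<pi>Hom[OF that] \<pi>_eq[OF that] by (simp_all add: in_Hom_iff)
  define d where "d j = fst (snd (on_arr ?P (\<pi> j)))" for j
  have d: "on_arr ?P (\<pi> j) = (fst (pb p), d j, fst (pb (on_ob D j)))"
      "d j \<in> Arr C" "Dom C (d j) = Dom C (fst (pb p))" "Cod C (d j) = Dom C (fst (pb (on_ob D j)))"
      "fst (pb (on_ob D j)) \<cdot> d j = fst (pb p)" "snd (pb (on_ob D j)) \<cdot> d j = c j \<cdot> snd (pb p)"
    if "j \<in> Ob J" for j
  proof -
    have "(p, c j, on_ob D j) \<in> Arr ?K"
      using \<pi>Hom[OF that] \<pi>_eq[OF that] by (simp add: in_Hom_iff)
    then obtain h where h: "on_arr ?P (p, c j, on_ob D j) = (fst (pb p), h, fst (pb (on_ob D j)))"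
      "h \<in> Arr C" "Dom C h = Dom C (fst (pb p))" "Cod C h = Dom C (fst (pb (on_ob D j)))"
      "fst (pb (on_ob D j)) \<cdot> h = fst (pb p)" "snd (pb (on_ob D j)) \<cdot> h = c j \<cdot> snd (pb p)"
      by (rule pb_arr)
    have "d j = h" unfolding d_def \<pi>_eq[OF that] h(1) by simp
    then show "on_arr ?P (\<pi> j) = (fst (pb p), d j, fst (pb (on_ob D j)))"
      "d j \<in> Arr C" "Dom C (d j) = Dom C (fst (pb p))" "Cod C (d j) = Dom C (fst (pb (on_ob D j)))"
      "fst (pb (on_ob D j)) \<cdot> d j = fst (pb p)" "snd (pb (on_ob D j)) \<cdot> d j = c j \<cdot> snd (pb p)"
      using h \<pi>_eq[OF that] by simp_all
  qed
  have "\<exists>!k. k \<in> Hom ?I m (on_ob ?P p) \<and> (\<forall>j\<in>Ob J. on_arr ?P (\<pi> j) \<cdot>\<^bsub>?I\<^esub> k = \<mu> j)"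
    if M: "is_cone J ?I (comp_func ?P D) m \<mu>" for m \<mu>
  proof -
    have m: "m \<in> Arr C" "Cod C m = Dom C u"
      and \<mu>Hom: "\<And>j. j \<in> Ob J \<Longrightarrow> \<mu> j \<in> Hom ?I m (fst (pb (on_ob D j)))"
      and \<mu>nat: "\<And>v. v \<in> Arr J \<Longrightarrow> on_arr ?P (on_arr D v) \<cdot>\<^bsub>?I\<^esub> \<mu> (Dom J v) = \<mu> (Cod J v)"
      using M by (simp_all add: is_cone_def comp_func_def pullback_map_def)
    define b where "b j = fst (snd (\<mu> j))" for j
    have \<mu>_eq: "\<mu> j = (m, b j, fst (pb (on_ob D j)))" if "j \<in> Ob J" for j
      using Hom_slice_shape[OF \<mu>Hom[OF that]] by (simp add: b_def)
    have b: "b j \<in> Arr C" "Dom C (b j) = Dom C m" "Cod C (b j) = Dom C (fst (pb (on_ob D j)))"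
        "fst (pb (on_ob D j)) \<cdot> b j = m" if "j \<in> Ob J" for j
      using \<mu>Hom[OF that] \<mu>_eq[OF that] by (simp_all add: in_Hom_iff)
    \<comment> \<open>The transposed cone has vertex \<open>u \<cdot> m\<close>; its legs are the
      given ones followed by the second projections of the pullbacks.\<close>
    let ?\<nu> = "\<lambda>j. (u \<cdot> m, snd (pb (on_ob D j)) \<cdot> b j, on_ob D j)"
    have sq: "on_ob D j \<cdot> (snd (pb (on_ob D j)) \<cdot> b j) = u \<cdot> m" if "j \<in> Ob J" for j
      using Cmp_reassoc[OF pb_simps(6)[OF D_ob[OF that]], of "b j"] that D_ob b u by simp
    have nat: "fst (snd (on_arr D v)) \<cdot> (snd (pb (on_ob D (Dom J v))) \<cdot> b (Dom J v)) =
          snd (pb (on_ob D (Cod J v))) \<cdot> b (Cod J v) \<and>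
        on_arr D v = (on_ob D (Dom J v), fst (snd (on_arr D v)), on_ob D (Cod J v))"
      if v: "v \<in> Arr J" for v
    proof -
      let ?i = "Dom J v" and ?j = "Cod J v"
      have ij: "?i \<in> Ob J" "?j \<in> Ob J" using v by simp_all
      obtain e where e: "on_arr D v = (on_ob D ?i, e, on_ob D ?j)" "e \<in> Arr C"
          "Dom C e = Dom C (on_ob D ?i)" "Cod C e = Dom C (on_ob D ?j)"
        by (rule functor_to_slice_arr[OF D v])
      have "(on_ob D ?i, e, on_ob D ?j) \<in> Arr ?K"
        using is_functorD(2)[OF D v] e(1) by simp
      then obtain h where h: "on_arr ?P (on_ob D ?i, e, on_ob D ?j) =
            (fst (pb (on_ob D ?i)), h, fst (pb (on_ob D ?j)))"
          "h \<in> Arr C" "Dom C h = Dom C (fst (pb (on_ob D ?i)))" "Cod C h = Dom C (fst (pb (on_ob D ?j)))"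
          "fst (pb (on_ob D ?j)) \<cdot> h = fst (pb (on_ob D ?i))"
          "snd (pb (on_ob D ?j)) \<cdot> h = e \<cdot> snd (pb (on_ob D ?i))"
        by (rule pb_arr)
      have hb: "h \<cdot> b ?i = b ?j"
        using \<mu>nat[OF v] unfolding e(1) h(1) \<mu>_eq[OF ij(1)] \<mu>_eq[OF ij(2)] by simp
      have "e \<cdot> (snd (pb (on_ob D ?i)) \<cdot> b ?i) = snd (pb (on_ob D ?j)) \<cdot> (h \<cdot> b ?i)"
        using Cmp_reassoc[OF h(6), of "b ?i"] h(2-4) e(2-) b[OF ij(1)] D_ob[OF ij(1)] D_ob[OF ij(2)]
        by simp
      then show ?thesis
        by (simp add: hb e(1))
    qed
    have "is_cone J ?K D (u \<cdot> m) ?\<nu>"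
      unfolding is_cone_def
    proof (intro conjI ballI)
      show "u \<cdot> m \<in> Ob ?K" using u m by simp
    next
      fix j assume "j \<in> Ob J"
      then show "?\<nu> j \<in> Hom ?K (u \<cdot> m) (on_ob D j)"
        using u m b[of j] D_ob[of j] sq[of j] by (simp add: in_Hom_iff)
    next
      fix v assume "v \<in> Arr J"
      from nat[OF this] show "on_arr D v \<cdot>\<^bsub>?K\<^esub> ?\<nu> (Dom J v) = ?\<nu> (Cod J v)"
        by (metis slice_simps(5))
    qed
    then have ex: "\<exists>!k. k \<in> Hom ?K (u \<cdot> m) p \<and> (\<forall>j\<in>Ob J. \<pi> j \<cdot>\<^bsub>?K\<^esub> k = ?\<nu> j)"
      using L unfolding is_limit_def by blast
    have iff: "(u \<cdot> m, k, p) \<in> Hom ?K (u \<cdot> m) p \<and> (\<forall>j\<in>Ob J. \<pi> j \<cdot>\<^bsub>?K\<^esub> (u \<cdot> m, k, p) = ?\<nu> j) \<longleftrightarrow>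
        k \<in> Hom C (Dom C m) (Dom C p) \<and> p \<cdot> k = u \<cdot> m \<and>
        (\<forall>j\<in>Ob J. c j \<cdot> k = snd (pb (on_ob D j)) \<cdot> b j)" for k
      using \<pi>_eq p u m by (auto simp: in_Hom_iff)
    have ex': "\<exists>!k. k \<in> Hom C (Dom C m) (Dom C p) \<and> p \<cdot> k = u \<cdot> m \<and>
        (\<forall>j\<in>Ob J. c j \<cdot> k = snd (pb (on_ob D j)) \<cdot> b j)" (is "\<exists>!k. ?A k")
      unfolding iff[symmetric]
      by (rule Ex1_reindex[of "\<lambda>k. (u \<cdot> m, k, p)", THEN iffD1, OF _ refl _ ex])
        (use Hom_slice_shape[of _ C "Cod C u" "u \<cdot> m" p] in \<open>auto simp: inj_def\<close>)
    \<comment> \<open>Transposition of fillers is \<open>h\<close> to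
      \<open>snd (pb p) \<cdot> h\<close>. The equations for \<open>d j\<close> and for
      \<open>c j\<close> are equivalent because the first projections agree already, so only the
      second ones can distinguish \<open>d j \<cdot> h\<close> from \<open>b j\<close>.\<close>
    have lift: "?A (snd (pb p) \<cdot> h) \<and> h \<in> Hom C (Dom C m) (Dom C (fst (pb p))) \<and> fst (pb p) \<cdot> h = m \<longleftrightarrow>
        h \<in> Hom C (Dom C m) (Dom C (fst (pb p))) \<and> fst (pb p) \<cdot> h = m \<and> (\<forall>j\<in>Ob J. d j \<cdot> h = b j)"
      for h
    proof (cases "h \<in> Hom C (Dom C m) (Dom C (fst (pb p))) \<and> fst (pb p) \<cdot> h = m")
      case True
      then have h: "h \<in> Arr C" "Dom C h = Dom C m" "Cod C h = Dom C (fst (pb p))" "fst (pb p) \<cdot> h = m"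
        by (simp_all add: in_Hom_iff)
      have ph: "p \<cdot> (snd (pb p) \<cdot> h) = u \<cdot> m"
        using Cmp_reassoc[OF pb_simps(6)[OF p], of h] h p u by simp
      have "c j \<cdot> (snd (pb p) \<cdot> h) = snd (pb (on_ob D j)) \<cdot> b j \<longleftrightarrow> d j \<cdot> h = b j"
        if j: "j \<in> Ob J" for j
      proof -
        have 1: "c j \<cdot> (snd (pb p) \<cdot> h) = snd (pb (on_ob D j)) \<cdot> (d j \<cdot> h)"
          using Cmp_reassoc[OF d(6)[OF j], of h] h(1,3) p c[OF j] d(2-4)[OF j] D_ob[OF j] by simp
        have 2: "fst (pb (on_ob D j)) \<cdot> (d j \<cdot> h) = fst (pb (on_ob D j)) \<cdot> b j"
          using Cmp_reassoc[OF d(5)[OF j], of h] h d(2-4)[OF j] D_ob[OF j] b(4)[OF j] by simp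
        show ?thesis
          unfolding 1
          using pb_eqI[OF D_ob[OF j] _ _ 2, of "Dom C m"] h d(2-4)[OF j] b[OF j]
          by (auto simp: in_Hom_iff)
      qed
      then show ?thesis
        using True ph h p by (simp add: in_Hom_iff)
    qed auto
    have iffI: "(m, h, fst (pb p)) \<in> Hom ?I m (on_ob ?P p) \<and>
          (\<forall>j\<in>Ob J. on_arr ?P (\<pi> j) \<cdot>\<^bsub>?I\<^esub> (m, h, fst (pb p)) = \<mu> j) \<longleftrightarrow>
        h \<in> Hom C (Dom C m) (Dom C (fst (pb p))) \<and> fst (pb p) \<cdot> h = m \<and> (\<forall>j\<in>Ob J. d j \<cdot> h = b j)" for h
      using d(1) \<mu>_eq p m by (auto simp: in_Hom_iff pullback_map_def)
    obtain k where k: "?A k" and k_uniq: "\<And>k'. ?A k' \<Longrightarrow> k' = k"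
      using ex' by blast
    have "\<exists>!h. h \<in> Hom C (Dom C m) (Dom C (fst (pb p))) \<and> fst (pb p) \<cdot> h = m \<and> snd (pb p) \<cdot> h = k"
      using k p m by (intro pb_lift) (auto simp: in_Hom_iff)
    then have "\<exists>!h. ?A (snd (pb p) \<cdot> h) \<and> h \<in> Hom C (Dom C m) (Dom C (fst (pb p))) \<and> fst (pb p) \<cdot> h = m"
      using k k_uniq by metis
    then have "\<exists>!h. (m, h, fst (pb p)) \<in> Hom ?I m (on_ob ?P p) \<and>
          (\<forall>j\<in>Ob J. on_arr ?P (\<pi> j) \<cdot>\<^bsub>?I\<^esub> (m, h, fst (pb p)) = \<mu> j)"
      unfolding lift iffI .
    then show ?thesis
      by (rule Ex1_reindex[of "\<lambda>h. (m, h, fst (pb p))", THEN iffD2, OF _ refl _, rotated -1])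
        (use Hom_slice_shape[of _ C "Dom C u" m "fst (pb p)"] in \<open>auto simp: inj_def pullback_map_def\<close>)
  qed
  then show ?thesis
    using cone unfolding is_limit_def by blast
qed

end


section \<open>Objects of sections\<close>

text \<open>Links \<open>is_binary_product\<close> to \<open>preserves_finite_limits\<close>. Every
  arrow is an identity, named by its object, so composable arrows are equal and returning either
  factor is correct.\<close>

definition discrete_two :: "(nat, nat) cat" where
  "discrete_two = \<lparr>Ob = {0, 1}, Arr = {0, 1}, Dom = (\<lambda>j. j), Cod = (\<lambda>j. j), Id = (\<lambda>j. j),
     Cmp = (\<lambda>v u. u)\<rparr>"

definition pair_diagram :: "('o, 'a) cat \<Rightarrow> 'o \<Rightarrow> 'o \<Rightarrow> (nat, nat, 'o, 'a) func" where
  "pair_diagram C A B = \<lparr>on_ob = case_nat A (\<lambda>_. B), on_arr = case_nat (Id C A) (\<lambda>_. Id C B)\<rparr>"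

lemma category_discrete_two: "category discrete_two"
  by unfold_locales (auto simp: discrete_two_def in_Hom_iff)

lemma (in category) is_functor_pair_diagram:
  assumes "A \<in> Ob C" "B \<in> Ob C"
  shows "is_functor discrete_two C (pair_diagram C A B)"
  using assms category_discrete_two category_axioms
  by (auto simp: is_functor_def discrete_two_def pair_diagram_def in_Hom_iff)

lemma (in category) is_limit_pair_iff:
  assumes "A \<in> Ob C" "B \<in> Ob C"
  shows "is_limit discrete_two C (pair_diagram C A B) P (case_nat p (\<lambda>_. q)) \<longleftrightarrow>
    is_binary_product C A B P p q"
proof -
  have cone: "is_cone discrete_two C (pair_diagram C A B) M \<mu> \<longleftrightarrow>
      M \<in> Ob C \<and> \<mu> 0 \<in> Hom C M A \<and> \<mu> (Suc 0) \<in> Hom C M B" for M \<mu>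
    using assms by (auto simp: is_cone_def discrete_two_def pair_diagram_def in_Hom_iff)
  \<comment> \<open>Only the legs at \<open>0\<close> and \<open>Suc 0\<close> are constrained, so
    quantifying over families of legs amounts to quantifying over pairs.\<close>
  have all: "(\<forall>\<mu>::nat \<Rightarrow> 'a. R (\<mu> 0) (\<mu> (Suc 0))) \<longleftrightarrow> (\<forall>f g. R f g)" for R :: "'a \<Rightarrow> 'a \<Rightarrow> bool"
  proof
    assume R: "\<forall>\<mu>. R (\<mu> 0) (\<mu> (Suc 0))"
    show "\<forall>f g. R f g"
      using R[rule_format, of "case_nat f (\<lambda>_. g)" for f g] by simp
  qed simp
  show ?thesis
    unfolding is_limit_def cone is_binary_product_def
    by (simp add: discrete_two_def all[of "\<lambda>f g. _ \<and> f \<in> _ \<and> g \<in> _ \<longrightarrow> (\<exists>!h. _ h \<and> _ h = f \<and> _ h = g)"]) blast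
qed

lemma preserves_binary_products:
  assumes F: "is_functor C D F" and pres: "preserves_finite_limits C D F"
    and P: "is_binary_product C A B P p q"
  shows "is_binary_product D (on_ob F A) (on_ob F B) (on_ob F P) (on_arr F p) (on_arr F q)"
proof -
  interpret C: category C by (rule is_functorD(7)[OF F])
  interpret D: category D by (rule is_functorD(8)[OF F])
  have AB: "A \<in> Ob C" "B \<in> Ob C"
    using P by (auto simp: is_binary_product_def in_Hom_iff)
  have fin: "finite (Ob discrete_two)" "finite (Arr discrete_two)"
    by (simp_all add: discrete_two_def)
  have "is_limit discrete_two C (pair_diagram C A B) P (case_nat p (\<lambda>_. q))"
    using P C.is_limit_pair_iff[OF AB] by simp
  then have "is_limit discrete_two D (comp_func F (pair_diagram C A B)) (on_ob F P)
      (\<lambda>j. on_arr F (case_nat p (\<lambda>_. q) j))"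
    using pres fin category_discrete_two C.is_functor_pair_diagram[OF AB]
    unfolding preserves_finite_limits_def by blast
  also have "?this \<longleftrightarrow> is_limit discrete_two D (pair_diagram D (on_ob F A) (on_ob F B)) (on_ob F P)
      (case_nat (on_arr F p) (\<lambda>_. on_arr F q))"
    by (rule is_limit_cong[OF category_discrete_two])
      (use AB is_functorD(5)[OF F] in
        \<open>auto simp: discrete_two_def comp_func_def pair_diagram_def split: nat.split\<close>)
  finally show ?thesis
    using D.is_limit_pair_iff[OF is_functorD(1)[OF F AB(1)] is_functorD(1)[OF F AB(2)]] by simp
qed

section \<open>Exponentials in the base and the object of sections\<close>

context category
begin

lemma terminal_eqI:
  assumes "is_terminal C T" "f \<in> Arr C" "g \<in> Arr C" "Dom C f = Dom C g" "Cod C f = T" "Cod C g = T"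
  shows "f = g"
  using assms unfolding is_terminal_def in_Hom_iff by (metis Dom_in_Ob)

text \<open>Presents \<open>I\<close> as \<open>T \<times> I\<close>. With \<open>Z = T\<close>, the
  universal property of the object of sections then speaks of its points on one side and of sections
  \<open>I -> X\<close> on the other.\<close>

lemma terminal_binary_product:
  assumes T: "is_terminal C T" and t: "t \<in> Hom C I T"
  shows "is_binary_product C T I I t (Id C I)"
  unfolding is_binary_product_def
proof (intro conjI ballI)
  show "I \<in> Ob C" "t \<in> Hom C I T" "Id C I \<in> Hom C I I"
    using t by (auto simp: in_Hom_iff)
next
  fix Z f g assume Z: "Z \<in> Ob C" and fg: "f \<in> Hom C Z T" "g \<in> Hom C Z I"
  have "t \<cdot> g = f"
    by (rule terminal_eqI[OF T]) (use t fg in \<open>simp_all add: in_Hom_iff\<close>)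
  then show "\<exists>!h. h \<in> Hom C Z I \<and> t \<cdot> h = f \<and> Id C I \<cdot> h = g"
    using fg by (intro ex1I[of _ g]) (auto simp: in_Hom_iff)
qed

lemma cartesian_closed_of_locally:
  assumes "locally_cartesian_closed C" "is_terminal C T"
  shows "cartesian_closed C"
  using category_iso.cartesian_closed_image[OF slice_terminal_iso[OF assms(2)]] assms
  by (simp add: locally_cartesian_closed_def is_terminal_def)

lemma exponential_ex1:
  assumes E: "is_exponential C A B E P p q ev" and R: "is_binary_product C Z A R r s"
    and f: "f \<in> Hom C R B"
  shows "\<exists>!g. g \<in> Hom C Z E \<and> (\<exists>x\<in>Hom C R P. p \<cdot> x = g \<cdot> r \<and> q \<cdot> x = s \<and> ev \<cdot> x = f)"
proof -
  have "Z \<in> Ob C"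
    using R by (auto simp: is_binary_product_def in_Hom_iff)
  with assms show ?thesis
    by (simp add: is_exponential_def)
qed

lemma exponential_transpose:
  assumes "is_exponential C A B E P p q ev" "is_binary_product C Z A R r s" "f \<in> Hom C R B"
  obtains g x where "g \<in> Arr C" "Dom C g = Z" "Cod C g = E" "x \<in> Arr C" "Dom C x = R" "Cod C x = P"
    "p \<cdot> x = g \<cdot> r" "q \<cdot> x = s" "ev \<cdot> x = f"
  using ex1_implies_ex[OF exponential_ex1[OF assms]] unfolding Bex_def in_Hom_iff by blast

lemma binary_product_pair:
  assumes "is_binary_product C A B P p q" "Z \<in> Ob C" "f \<in> Hom C Z A" "g \<in> Hom C Z B"
  obtains h where "h \<in> Arr C" "Dom C h = Z" "Cod C h = P" "p \<cdot> h = f" "q \<cdot> h = g"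
  using ex1_implies_ex[OF binary_product_ex1[OF assms]] unfolding in_Hom_iff by blast

text \<open>\<open>S\<close> is the pullback of \<open>p\<^sup>I : X\<^sup>I \<rightarrow> I\<^sup>I\<close> along the name \<open>T \<rightarrow> I\<^sup>I\<close> of the identity.\<close>

lemma section_object:
  assumes lcc: "locally_cartesian_closed C" and T: "is_terminal C T" and p: "p \<in> Hom C X I"
  obtains S R r s ev where "is_binary_product C S I R r s" "ev \<in> Hom C R X" "p \<cdot> ev = s"
    "\<And>Z Q q1 q2 k. is_binary_product C Z I Q q1 q2 \<Longrightarrow> k \<in> Hom C Q X \<Longrightarrow> p \<cdot> k = q2 \<Longrightarrow>
      \<exists>!g. g \<in> Hom C Z S \<and> (\<exists>x\<in>Hom C Q R. r \<cdot> x = g \<cdot> q1 \<and> s \<cdot> x = q2 \<and> ev \<cdot> x = k)"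
proof -
  have cc: "cartesian_closed C"
    using lcc T by (rule cartesian_closed_of_locally)
  have p': "p \<in> Arr C" "Dom C p = X" "Cod C p = I" and I: "I \<in> Ob C" and X: "X \<in> Ob C"
    using p by (auto simp: in_Hom_iff)
  have TO: "T \<in> Ob C" using T by (simp add: is_terminal_def)
  obtain E P a b e where E: "is_exponential C I X E P a b e"
    using cc I X unfolding cartesian_closed_def by blast
  obtain E' P' a' b' e' where E': "is_exponential C I I E' P' a' b' e'"
    using cc I unfolding cartesian_closed_def by blast
  have P: "is_binary_product C E I P a b" and e: "e \<in> Hom C P X"
    and P': "is_binary_product C E' I P' a' b'" and e': "e' \<in> Hom C P' I"
    using E E' by (simp_all add: is_exponential_def)
  have ab [simp]: "a \<in> Arr C" "Dom C a = P" "Cod C a = E" "b \<in> Arr C" "Dom C b = P" "Cod C b = I"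
    "e \<in> Arr C" "Dom C e = P" "Cod C e = X" "P \<in> Ob C"
    "a' \<in> Arr C" "Dom C a' = P'" "Cod C a' = E'" "b' \<in> Arr C" "Dom C b' = P'" "Cod C b' = I"
    "e' \<in> Arr C" "Dom C e' = P'" "Cod C e' = I" "P' \<in> Ob C"
    using P P' e e' by (simp_all add: is_binary_product_def in_Hom_iff)
  note [simp] = p' I X TO
  have transpose: "\<exists>!g. g \<in> Hom C Z E \<and> (\<exists>x\<in>Hom C Q P. a \<cdot> x = g \<cdot> q1 \<and> b \<cdot> x = q2 \<and> e \<cdot> x = k)"
    if "is_binary_product C Z I Q q1 q2" "k \<in> Hom C Q X" for Z Q q1 q2 k
    by (rule exponential_ex1[OF E that])
  have transpose': "\<exists>!g. g \<in> Hom C Z E' \<and> (\<exists>x\<in>Hom C Q P'. a' \<cdot> x = g \<cdot> q1 \<and> b' \<cdot> x = q2 \<and> e' \<cdot> x = k)"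
    if "is_binary_product C Z I Q q1 q2" "k \<in> Hom C Q I" for Z Q q1 q2 k
    by (rule exponential_ex1[OF E' that])
  obtain t where t: "t \<in> Hom C I T"
    using T I unfolding is_terminal_def by blast
  \<comment> \<open>\<open>pI\<close> is \<open>p\<^sup>I\<close>, the transpose of
    \<open>p \<cdot> e\<close>; \<open>x1\<close> is \<open>pI \<times> I\<close>.\<close>
  obtain pI x1 where pI [simp]: "pI \<in> Arr C" "Dom C pI = E" "Cod C pI = E'"
    and x1 [simp]: "x1 \<in> Arr C" "Dom C x1 = P" "Cod C x1 = P'"
    and x1_eq: "a' \<cdot> x1 = pI \<cdot> a" "b' \<cdot> x1 = b" "e' \<cdot> x1 = p \<cdot> e"
    by (rule exponential_transpose[OF E' P, of "p \<cdot> e"]) (simp add: in_Hom_iff)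
  \<comment> \<open>\<open>nm\<close> is the name of the identity: the transpose of
    \<open>Id C I\<close>, with \<open>I\<close> regarded as \<open>T \<times> I\<close>.\<close>
  obtain nm x2 where nm [simp]: "nm \<in> Arr C" "Dom C nm = T" "Cod C nm = E'"
    and x2 [simp]: "x2 \<in> Arr C" "Dom C x2 = I" "Cod C x2 = P'"
    and x2_eq: "a' \<cdot> x2 = nm \<cdot> t" "b' \<cdot> x2 = Id C I" "e' \<cdot> x2 = Id C I"
    by (rule exponential_transpose[OF E' terminal_binary_product[OF T t], of "Id C I"])
      (simp add: in_Hom_iff)
  have t [simp]: "t \<in> Arr C" "Dom C t = I" "Cod C t = T"
    using t by (simp_all add: in_Hom_iff)
  obtain pb where "pullback_choice C pI pb"
    using pullback_choice_exists[OF lcc pI(1)] by blast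
  then have "is_pullback C pI nm (fst (pb nm)) (snd (pb nm))"
    by (simp add: pullback_choice_def)
  then obtain i tS where pull: "is_pullback C pI nm i tS"
    by blast
  define S where "S = Dom C i"
  have S [simp]: "i \<in> Arr C" "Dom C i = S" "Cod C i = E" "tS \<in> Arr C" "Dom C tS = S" "Cod C tS = T"
    and i_eq: "pI \<cdot> i = nm \<cdot> tS"
    using pull by (simp_all add: is_pullback_def S_def)
  have SO [simp]: "S \<in> Ob C" using S by (metis Dom_in_Ob)
  obtain R r s where R: "is_binary_product C S I R r s"
    using cc SO I has_binary_products unfolding cartesian_closed_def by metis
  have rs [simp]: "r \<in> Arr C" "Dom C r = R" "Cod C r = S" "s \<in> Arr C" "Dom C s = R" "Cod C s = I"
    "R \<in> Ob C"
    using R by (simp_all add: is_binary_product_def in_Hom_iff)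
  \<comment> \<open>\<open>w\<close> is \<open>i \<times> I\<close>, so evaluation at
    \<open>S\<close> is the evaluation \<open>e\<close> restricted along \<open>i\<close>.\<close>
  obtain w where w [simp]: "w \<in> Arr C" "Dom C w = R" "Cod C w = P"
    and w_eq: "a \<cdot> w = i \<cdot> r" "b \<cdot> w = s"
    by (rule binary_product_pair[OF P, of R "i \<cdot> r" s]) (simp_all add: in_Hom_iff)
  note re = x1_eq[THEN Cmp_reassoc] x2_eq[THEN Cmp_reassoc] i_eq[THEN Cmp_reassoc]
    w_eq[THEN Cmp_reassoc]
  have ts: "t \<cdot> s = tS \<cdot> r"
    by (rule terminal_eqI[OF T]) simp_all
  \<comment> \<open>The second projections are both \<open>s\<close>, and the first agree by the
    pullback square of \<open>S\<close>. Composing with \<open>e'\<close> then says that evaluation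
    is a section: \<open>p \<cdot> (e \<cdot> w) = s\<close>.\<close>
  have "x1 \<cdot> w = x2 \<cdot> s"
    by (rule binary_product_eqI[OF P', of _ R])
      (simp_all add: in_Hom_iff re x1_eq x2_eq w_eq i_eq ts)
  then have "e' \<cdot> (x1 \<cdot> w) = e' \<cdot> (x2 \<cdot> s)"
    by simp
  then have pev: "p \<cdot> (e \<cdot> w) = s"
    by (simp add: re)
  have univ: "\<exists>!g. g \<in> Hom C Z S \<and> (\<exists>x\<in>Hom C Q R. r \<cdot> x = g \<cdot> q1 \<and> s \<cdot> x = q2 \<and> (e \<cdot> w) \<cdot> x = k)"
    if Q: "is_binary_product C Z I Q q1 q2" and k: "k \<in> Hom C Q X" and pk: "p \<cdot> k = q2"
    for Z Q q1 q2 k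
  proof -
    have q [simp]: "q1 \<in> Arr C" "Dom C q1 = Q" "Cod C q1 = Z" "q2 \<in> Arr C" "Dom C q2 = Q"
      "Cod C q2 = I" "Q \<in> Ob C"
      using Q by (simp_all add: is_binary_product_def in_Hom_iff)
    have ZO [simp]: "Z \<in> Ob C" using q by (metis Cod_in_Ob)
    have k' [simp]: "k \<in> Arr C" "Dom C k = Q" "Cod C k = X"
      using k by (simp_all add: in_Hom_iff)
    note ex1_transpose = transpose[OF Q k]
    obtain c v where c [simp]: "c \<in> Arr C" "Dom C c = Z" "Cod C c = E"
      and v [simp]: "v \<in> Arr C" "Dom C v = Q" "Cod C v = P"
      and v_eq: "a \<cdot> v = c \<cdot> q1" "b \<cdot> v = q2" "e \<cdot> v = k"
      by (rule exponential_transpose[OF E Q k])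
    obtain z where z [simp]: "z \<in> Arr C" "Dom C z = Z" "Cod C z = T"
      using T ZO unfolding is_terminal_def in_Hom_iff by blast
    have tq: "t \<cdot> q2 = z \<cdot> q1"
      by (rule terminal_eqI[OF T]) simp_all
    \<comment> \<open>Since \<open>p \<cdot> k = q2\<close>, both \<open>pI \<cdot> c\<close> and
      \<open>nm \<cdot> z\<close> are transposes of \<open>q2\<close>. Hence they coincide and
      \<open>c\<close> factors through the pullback \<open>S\<close>.\<close>
    have "pI \<cdot> c \<in> Hom C Z E' \<and> (\<exists>x\<in>Hom C Q P'. a' \<cdot> x = (pI \<cdot> c) \<cdot> q1 \<and> b' \<cdot> x = q2 \<and> e' \<cdot> x = q2)"
      by (intro conjI bexI[of _ "x1 \<cdot> v"]) (simp_all add: in_Hom_iff re v_eq pk)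
    moreover have "nm \<cdot> z \<in> Hom C Z E' \<and> (\<exists>x\<in>Hom C Q P'. a' \<cdot> x = (nm \<cdot> z) \<cdot> q1 \<and> b' \<cdot> x = q2 \<and> e' \<cdot> x = q2)"
      by (intro conjI bexI[of _ "x2 \<cdot> q2"]) (simp_all add: in_Hom_iff re tq)
    moreover have "q2 \<in> Hom C Q I" by (simp add: in_Hom_iff)
    ultimately have "pI \<cdot> c = nm \<cdot> z"
      using transpose'[OF Q, of q2] by blast
    then have "\<exists>!g. g \<in> Hom C Z (Dom C i) \<and> i \<cdot> g = c \<and> tS \<cdot> g = z"
      by (intro pullback_ex1[OF pull]) (simp_all add: in_Hom_iff)
    then obtain g where g [simp]: "g \<in> Arr C" "Dom C g = Z" "Cod C g = S" and g_eq: "i \<cdot> g = c"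
      unfolding in_Hom_iff S by blast
    obtain x where x [simp]: "x \<in> Arr C" "Dom C x = Q" "Cod C x = R"
      and x_eq: "r \<cdot> x = g \<cdot> q1" "s \<cdot> x = q2"
      by (rule binary_product_pair[OF R, of Q "g \<cdot> q1" q2]) (simp_all add: in_Hom_iff)
    have "w \<cdot> x = v"
      by (rule binary_product_eqI[OF P, of _ Q])
        (simp_all add: in_Hom_iff re x_eq v_eq g_eq[THEN Cmp_reassoc])
    then have evx: "(e \<cdot> w) \<cdot> x = k"
      using v_eq by simp
    show ?thesis
    proof (rule ex1I[of _ g])
      show "g \<in> Hom C Z S \<and> (\<exists>x\<in>Hom C Q R. r \<cdot> x = g \<cdot> q1 \<and> s \<cdot> x = q2 \<and> (e \<cdot> w) \<cdot> x = k)"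
        using x_eq evx by (intro conjI bexI[of _ x]) (simp_all add: in_Hom_iff)
    next
      fix g' assume "g' \<in> Hom C Z S \<and> (\<exists>x\<in>Hom C Q R. r \<cdot> x = g' \<cdot> q1 \<and> s \<cdot> x = q2 \<and> (e \<cdot> w) \<cdot> x = k)"
      then obtain x' where g' [simp]: "g' \<in> Arr C" "Dom C g' = Z" "Cod C g' = S"
        and x' [simp]: "x' \<in> Arr C" "Dom C x' = Q" "Cod C x' = R"
        and x'_eq: "r \<cdot> x' = g' \<cdot> q1" "s \<cdot> x' = q2" "(e \<cdot> w) \<cdot> x' = k"
        unfolding Bex_def in_Hom_iff by blast
      \<comment> \<open>\<open>i \<cdot> g'\<close> is another transpose of \<open>k\<close> into
        the full exponential, so it equals \<open>c\<close>; the other projection of the pullback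
        lands in \<open>T\<close> and imposes nothing.\<close>
      have "i \<cdot> g' \<in> Hom C Z E \<and> (\<exists>x\<in>Hom C Q P. a \<cdot> x = (i \<cdot> g') \<cdot> q1 \<and> b \<cdot> x = q2 \<and> e \<cdot> x = k)"
        using x'_eq by (intro conjI bexI[of _ "w \<cdot> x'"]) (simp_all add: in_Hom_iff re)
      moreover have "c \<in> Hom C Z E \<and> (\<exists>x\<in>Hom C Q P. a \<cdot> x = c \<cdot> q1 \<and> b \<cdot> x = q2 \<and> e \<cdot> x = k)"
        using v_eq by (intro conjI bexI[of _ v]) (simp_all add: in_Hom_iff)
      ultimately have "i \<cdot> g' = c"
        using ex1_transpose by blast
      moreover have "tS \<cdot> g' = tS \<cdot> g"
        by (rule terminal_eqI[OF T]) simp_all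
      ultimately show "g' = g"
        using g_eq by - (rule pullback_eqI[OF pull, of g' Z g]; simp add: in_Hom_iff)
    qed
  qed
  show thesis
    by (rule that[OF R _ pev univ]) (simp_all add: in_Hom_iff)
qed

end

section \<open>The later functor on a slice\<close>

locale guarded_slice = pullback_along C "nxt I" pb
  for C :: "('o, 'a) cat" (structure) and later :: "('o, 'a, 'o, 'a) func" and nxt :: "'o \<Rightarrow> 'a"
    and I :: 'o and pb :: "'a \<Rightarrow> 'a \<times> 'a" +
  assumes model: "guarded_model C later nxt" and lcc: "locally_cartesian_closed C"
    and I [simp]: "I \<in> Ob C"
begin

lemma later_functor: "is_functor C C later"
  using model by (simp add: guarded_model_def)

lemma later_simps [simp]:
  "X \<in> Ob C \<Longrightarrow> on_ob later X \<in> Ob C"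
  "f \<in> Arr C \<Longrightarrow> on_arr later f \<in> Arr C"
  "f \<in> Arr C \<Longrightarrow> Dom C (on_arr later f) = on_ob later (Dom C f)"
  "f \<in> Arr C \<Longrightarrow> Cod C (on_arr later f) = on_ob later (Cod C f)"
  using is_functorD(1-4)[OF later_functor] by simp_all

lemma later_Cmp:
  "f \<in> Arr C \<Longrightarrow> g \<in> Arr C \<Longrightarrow> Dom C g = Cod C f \<Longrightarrow>
    on_arr later (g \<cdot> f) = on_arr later g \<cdot> on_arr later f"
  by (rule is_functorD(6)[OF later_functor])

lemma nxt_simps [simp]:
  "X \<in> Ob C \<Longrightarrow> nxt X \<in> Arr C"
  "X \<in> Ob C \<Longrightarrow> Dom C (nxt X) = X"
  "X \<in> Ob C \<Longrightarrow> Cod C (nxt X) = on_ob later X"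
  using model by (simp_all add: guarded_model_def is_nat_trans_def id_func_def in_Hom_iff)

lemma nxt_natural:
  "f \<in> Arr C \<Longrightarrow> Dom C f = X \<Longrightarrow> Cod C f = Y \<Longrightarrow> on_arr later f \<cdot> nxt X = nxt Y \<cdot> f"
  using model by (auto simp: guarded_model_def is_nat_trans_def id_func_def)

lemma fixed_point:
  assumes "is_terminal C T" "X \<in> Ob C" "f \<in> Hom C (on_ob later X) X"
  shows "\<exists>!h. h \<in> Hom C T X \<and> f \<cdot> (nxt X \<cdot> h) = h"
  using model assms unfolding guarded_model_def by blast

text \<open>Naturality of \<open>nxt\<close> at \<open>p\<close> is the compatibility that makes the
  definite description in \<open>next_slice\<close> denote an arrow.\<close>

lemma next_slice_arr:
  assumes p: "p \<in> Arr C" "Cod C p = I"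
  obtains n where
    "next_slice C later nxt pb p = (p, n, fst (pb (on_arr later p)))"
    "n \<in> Arr C" "Dom C n = Dom C p" "Cod C n = Dom C (fst (pb (on_arr later p)))"
    "fst (pb (on_arr later p)) \<cdot> n = p" "snd (pb (on_arr later p)) \<cdot> n = nxt (Dom C p)"
proof -
  let ?q = "on_arr later p"
  let ?P = "\<lambda>h. h \<in> Hom C (Dom C p) (Dom C (fst (pb ?q))) \<and> fst (pb ?q) \<cdot> h = p \<and>
    snd (pb ?q) \<cdot> h = nxt (Dom C p)"
  define n where "n = The ?P"
  have "\<exists>!h. ?P h"
    using p nxt_natural[of p "Dom C p" I] by (intro pb_lift) simp_all
  from theI'[OF this] have n: "?P n"
    by (simp add: n_def)
  have "next_slice C later nxt pb p = (p, n, fst (pb ?q))"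
    by (simp add: next_slice_def n_def Let_def split: prod.split)
  with n show thesis
    by (intro that[of n]) (simp_all add: in_Hom_iff)
qed

lemma is_functor_later_slice: "is_functor (slice C I) (slice C I) (later_slice C later pb)"
  unfolding later_slice_def
  by (rule is_functor_comp[OF is_functor_slice_map[OF later_functor]])
    (use is_functor_pullback_map in simp)

lemma later_slice_preserves_finite_limits:
  "preserves_finite_limits (slice C I) (slice C I) (later_slice C later pb)"
  unfolding preserves_finite_limits_def
proof (intro allI impI)
  fix J :: "(nat, nat) cat" and D p \<pi>
  assume J: "category J" "finite (Ob J)" "finite (Arr J)" and D: "is_functor J (slice C I) D"
    and L: "is_limit J (slice C I) D p \<pi>"
  let ?L = "slice_map later"
  have L': "is_limit J (slice C (on_ob later I)) (comp_func ?L D) (on_ob ?L p) (\<lambda>j. on_arr ?L (\<pi> j))"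
    using slice_map_preserves_finite_limits[OF later_functor _ I] model J D L
    unfolding preserves_finite_limits_def guarded_model_def by blast
  have D': "is_functor J (slice C (on_ob later I)) (comp_func ?L D)"
    by (rule is_functor_comp[OF D is_functor_slice_map[OF later_functor]])
  have "is_limit J (slice C I) (comp_func (pullback_map C pb) (comp_func ?L D))
      (on_ob (pullback_map C pb) (on_ob ?L p)) (\<lambda>j. on_arr (pullback_map C pb) (on_arr ?L (\<pi> j)))"
    using pullback_map_preserves_limits[of J "comp_func ?L D"] D' L' by simp
  then show "is_limit J (slice C I) (comp_func (later_slice C later pb) D)
      (on_ob (later_slice C later pb) p) (\<lambda>j. on_arr (later_slice C later pb) (\<pi> j))"
    by (simp add: later_slice_def comp_func_def)
qed

lemma next_slice_natural:
  "is_nat_trans (slice C I) (slice C I) id_func (later_slice C later pb) (next_slice C later nxt pb)"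
proof -
  let ?S = "slice C I" and ?L = "later_slice C later pb" and ?n = "next_slice C later nxt pb"
  have "is_functor ?S ?S id_func"
    using category_slice category.Dom_in_Ob[OF category_slice] category.Cod_in_Ob[OF category_slice]
    by (auto simp: is_functor_def id_func_def in_Hom_iff)
  moreover have "?n p \<in> Hom ?S (on_ob id_func p) (on_ob ?L p)" if "p \<in> Ob ?S" for p
  proof -
    have p: "p \<in> Arr C" "Cod C p = I" using that by simp_all
    obtain n where "?n p = (p, n, fst (pb (on_arr later p)))"
      "n \<in> Arr C" "Dom C n = Dom C p" "Cod C n = Dom C (fst (pb (on_arr later p)))"
      "fst (pb (on_arr later p)) \<cdot> n = p"
      by (rule next_slice_arr[OF p])
    with p show ?thesis
      by (simp add: in_Hom_iff id_func_def later_slice_def comp_func_def pullback_map_def slice_map_def)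
  qed
  moreover have "on_arr ?L f \<cdot>\<^bsub>?S\<^esub> ?n (Dom ?S f) = ?n (Cod ?S f) \<cdot>\<^bsub>?S\<^esub> on_arr id_func f"
    if f: "f \<in> Arr ?S" for f
  proof -
    obtain p g q where feq: "f = (p, g, q)" by (rule prod_cases3)
    have p: "p \<in> Arr C" "Cod C p = I" and q: "q \<in> Arr C" "Cod C q = I"
      and g: "g \<in> Arr C" "Dom C g = Dom C p" "Cod C g = Dom C q" "q \<cdot> g = p"
      using f feq by simp_all
    obtain m where m: "?n p = (p, m, fst (pb (on_arr later p)))"
      "m \<in> Arr C" "Dom C m = Dom C p" "Cod C m = Dom C (fst (pb (on_arr later p)))"
      "fst (pb (on_arr later p)) \<cdot> m = p" "snd (pb (on_arr later p)) \<cdot> m = nxt (Dom C p)"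
      by (rule next_slice_arr[OF p])
    obtain n where n: "?n q = (q, n, fst (pb (on_arr later q)))"
      "n \<in> Arr C" "Dom C n = Dom C q" "Cod C n = Dom C (fst (pb (on_arr later q)))"
      "fst (pb (on_arr later q)) \<cdot> n = q" "snd (pb (on_arr later q)) \<cdot> n = nxt (Dom C q)"
      by (rule next_slice_arr[OF q])
    have "on_arr later q \<cdot> on_arr later g = on_arr later p"
      using later_Cmp[of g q] p q g by simp
    then have "(on_arr later p, on_arr later g, on_arr later q) \<in> Arr (slice C (Cod C (nxt I)))"
      using p q g(1-3) by simp
    then obtain h where h: "on_arr (pullback_map C pb) (on_arr later p, on_arr later g, on_arr later q) =
          (fst (pb (on_arr later p)), h, fst (pb (on_arr later q)))"
        "h \<in> Arr C" "Dom C h = Dom C (fst (pb (on_arr later p)))"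
        "Cod C h = Dom C (fst (pb (on_arr later q)))"
        "fst (pb (on_arr later q)) \<cdot> h = fst (pb (on_arr later p))"
        "snd (pb (on_arr later q)) \<cdot> h = on_arr later g \<cdot> snd (pb (on_arr later p))"
      by (rule pb_arr)
    have Lq: "on_arr later q \<in> Arr C" "Cod C (on_arr later q) = Cod C (nxt I)"
      using q by simp_all
    \<comment> \<open>Both projections of the pullback are compared: the first gives
      \<open>p\<close> on either side, the second is naturality of \<open>nxt\<close> at
      \<open>g\<close>.\<close>
    have "h \<cdot> m = n \<cdot> g"
      by (rule pb_eqI[OF Lq, of _ "Dom C p"])
        (use p q g m(2-) n(2-) h(2-) h(5,6)[THEN Cmp_reassoc] n(5,6)[THEN Cmp_reassoc]
          nxt_natural[of g] in \<open>simp_all add: in_Hom_iff\<close>)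
    then show ?thesis
      using h(1) m(1) n(1) by (simp add: feq later_slice_def comp_func_def slice_map_def id_func_def)
  qed
  ultimately show ?thesis
    using is_functor_later_slice by (simp add: is_nat_trans_def id_func_def)
qed

text \<open>The sections of \<open>p\<close> are the points of the object \<open>S\<close> of sections. Evaluating under \<open>later\<close>
  gives \<open>later S \<times> I \<rightarrow> later R \<rightarrow> later X\<close>, hence an arrow \<open>w\<close> into the pullback, and the
  transpose \<open>later S \<rightarrow> S\<close> of \<open>f \<cdot> w\<close> acts on points as \<open>f \<cdot> n\<close> acts on sections.\<close>

lemma section_fixed_point:
  assumes p: "p \<in> Arr C" "Cod C p = I"
    and f: "f \<in> Arr C" "Dom C f = Dom C (fst (pb (on_arr later p)))" "Cod C f = Dom C p"
      "p \<cdot> f = fst (pb (on_arr later p))"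
    and n: "n \<in> Arr C" "Dom C n = Dom C p" "Cod C n = Dom C (fst (pb (on_arr later p)))"
      "fst (pb (on_arr later p)) \<cdot> n = p" "snd (pb (on_arr later p)) \<cdot> n = nxt (Dom C p)"
  shows "\<exists>!h. h \<in> Hom C I (Dom C p) \<and> p \<cdot> h = Id C I \<and> f \<cdot> (n \<cdot> h) = h"
proof -
  define X where "X = Dom C p"
  define a where "a = fst (pb (on_arr later p))"
  define b where "b = snd (pb (on_arr later p))"
  define Y where "Y = Dom C a"
  have Lp: "on_arr later p \<in> Arr C" "Cod C (on_arr later p) = Cod C (nxt I)"
    using p by simp_all
  have X [simp]: "Dom C p = X" "X \<in> Ob C"
    using p by (simp_all add: X_def)
  have [simp]: "a \<in> Arr C" "Dom C a = Y" "Cod C a = I" "b \<in> Arr C" "Dom C b = Y"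
    "Cod C b = on_ob later X"
    using pb_simps[OF Lp] p by (simp_all add: a_def b_def Y_def)
  note [simp] = p f(1) n(1)
  have [simp]: "Dom C f = Y" "Cod C f = X" "Dom C n = X" "Cod C n = Y"
    using f n by (simp_all add: Y_def a_def)
  have f_eq: "p \<cdot> f = a" and n_eq: "a \<cdot> n = p" "b \<cdot> n = nxt X"
    using f n by (simp_all add: a_def b_def)
  have fp: "has_finite_products C"
    using model by (simp add: guarded_model_def)
  obtain T where T: "is_terminal C T"
    using fp by (rule has_terminal)
  then have TO [simp]: "T \<in> Ob C" by (simp add: is_terminal_def)
  obtain t where tH: "t \<in> Hom C I T"
    using T I unfolding is_terminal_def by blast
  then have t [simp]: "t \<in> Arr C" "Dom C t = I" "Cod C t = T"
    by (simp_all add: in_Hom_iff)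
  have "p \<in> Hom C X I" by (simp add: in_Hom_iff)
  then obtain S R r s ev where R: "is_binary_product C S I R r s" and evH: "ev \<in> Hom C R X"
    and ev_eq: "p \<cdot> ev = s"
    and univ: "\<And>Z Q q1 q2 k. is_binary_product C Z I Q q1 q2 \<Longrightarrow> k \<in> Hom C Q X \<Longrightarrow> p \<cdot> k = q2 \<Longrightarrow>
      \<exists>!g. g \<in> Hom C Z S \<and> (\<exists>x\<in>Hom C Q R. r \<cdot> x = g \<cdot> q1 \<and> s \<cdot> x = q2 \<and> ev \<cdot> x = k)"
    by (rule section_object[OF lcc T]) blast
  have rs [simp]: "r \<in> Arr C" "Dom C r = R" "Cod C r = S" "s \<in> Arr C" "Dom C s = R" "Cod C s = I"
    "R \<in> Ob C" "ev \<in> Arr C" "Dom C ev = R" "Cod C ev = X"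
    using R evH by (simp_all add: is_binary_product_def in_Hom_iff)
  have SO [simp]: "S \<in> Ob C" using rs by (metis Cod_in_Ob)
  have LR: "is_binary_product C (on_ob later S) (on_ob later I) (on_ob later R)
      (on_arr later r) (on_arr later s)"
    using preserves_binary_products[OF later_functor _ R] model by (simp add: guarded_model_def)
  obtain Q q1 q2 where Q: "is_binary_product C (on_ob later S) I Q q1 q2"
    using has_binary_products[OF fp, of "on_ob later S" I] by auto
  have q [simp]: "q1 \<in> Arr C" "Dom C q1 = Q" "Cod C q1 = on_ob later S"
    "q2 \<in> Arr C" "Dom C q2 = Q" "Cod C q2 = I" "Q \<in> Ob C"
    using Q by (simp_all add: is_binary_product_def in_Hom_iff)
  \<comment> \<open>\<open>later R\<close> is the product of \<open>later S\<close> and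
    \<open>later I\<close>, so \<open>v\<close> is the map
    \<open>later S \<times> I -> later S \<times> later I\<close> given by \<open>nxt I\<close> on
    the second factor.\<close>
  obtain v where v [simp]: "v \<in> Arr C" "Dom C v = Q" "Cod C v = on_ob later R"
    and v_eq: "on_arr later r \<cdot> v = q1" "on_arr later s \<cdot> v = nxt I \<cdot> q2"
    by (rule binary_product_pair[OF LR, of Q q1 "nxt I \<cdot> q2"]) (simp_all add: in_Hom_iff)
  have Lev: "on_arr later p \<cdot> on_arr later ev = on_arr later s"
    using later_Cmp[of ev p] ev_eq by simp
  \<comment> \<open>The square commutes because \<open>later\<close> applied to
    \<open>p \<cdot> ev = s\<close> gives
    \<open>on_arr later s \<cdot> v = nxt I \<cdot> q2\<close>.\<close>
  have "\<exists>!w. w \<in> Hom C (Dom C q2) (Dom C a) \<and> a \<cdot> w = q2 \<and> b \<cdot> w = on_arr later ev \<cdot> v"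
    unfolding a_def b_def
    by (rule pb_lift[OF Lp]) (simp_all add: Lev[THEN Cmp_reassoc] v_eq)
  then obtain w where w [simp]: "w \<in> Arr C" "Dom C w = Q" "Cod C w = Y"
    and w_eq: "a \<cdot> w = q2" "b \<cdot> w = on_arr later ev \<cdot> v"
    unfolding in_Hom_iff q Y_def[symmetric] by blast
  have fw: "f \<cdot> w \<in> Hom C Q X" "p \<cdot> (f \<cdot> w) = q2"
    by (simp_all add: in_Hom_iff f_eq[THEN Cmp_reassoc] w_eq)
  obtain g x where g [simp]: "g \<in> Arr C" "Dom C g = on_ob later S" "Cod C g = S"
    and x [simp]: "x \<in> Arr C" "Dom C x = Q" "Cod C x = R"
    and x_eq: "r \<cdot> x = g \<cdot> q1" "s \<cdot> x = q2" "ev \<cdot> x = f \<cdot> w"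
    using ex1_implies_ex[OF univ[OF Q fw]] unfolding Bex_def in_Hom_iff by blast
  \<comment> \<open>A point \<open>c\<close> of \<open>S\<close> becomes the pair of
    \<open>c \<cdot> t\<close> and \<open>Id C I\<close>; composing it with \<open>ev\<close> yields
    the section named by \<open>c\<close>.\<close>
  have point: "\<exists>y. y \<in> Arr C \<and> Dom C y = I \<and> Cod C y = R \<and> r \<cdot> y = c \<cdot> t \<and> s \<cdot> y = Id C I"
    if "c \<in> Hom C T S" for c
  proof -
    have "c \<cdot> t \<in> Hom C I S" "Id C I \<in> Hom C I I"
      using that by (simp_all add: in_Hom_iff)
    from ex1_implies_ex[OF binary_product_ex1[OF R I this]] show ?thesis
      unfolding in_Hom_iff by blast
  qed
  \<comment> \<open>If \<open>y\<close> represents the point \<open>c\<close> and \<open>y'\<close>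
    represents its image under \<open>g \<cdot> nxt S\<close>, then the section of \<open>y'\<close>
    is obtained from that of \<open>y\<close> by \<open>f \<cdot> n\<close>.\<close>
  have key: "ev \<cdot> y' = f \<cdot> (n \<cdot> (ev \<cdot> y))"
    if [simp]: "c \<in> Arr C" "Dom C c = T" "Cod C c = S"
      and [simp]: "y \<in> Arr C" "Dom C y = I" "Cod C y = R" and y: "r \<cdot> y = c \<cdot> t" "s \<cdot> y = Id C I"
      and [simp]: "y' \<in> Arr C" "Dom C y' = I" "Cod C y' = R"
      and y': "r \<cdot> y' = (g \<cdot> (nxt S \<cdot> c)) \<cdot> t" "s \<cdot> y' = Id C I"
    for c y y'
  proof -
    \<comment> \<open>\<open>z\<close> is the pair of the delayed point and the identity of
      \<open>I\<close>, the argument at which the transposed map \<open>f \<cdot> w\<close> is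
      evaluated.\<close>
    obtain z where z [simp]: "z \<in> Arr C" "Dom C z = I" "Cod C z = Q"
      and z_eq: "q1 \<cdot> z = nxt S \<cdot> (c \<cdot> t)" "q2 \<cdot> z = Id C I"
      by (rule binary_product_pair[OF Q I, of "nxt S \<cdot> (c \<cdot> t)" "Id C I"]) (simp_all add: in_Hom_iff)
    have y'_eq: "y' = x \<cdot> z"
      by (rule binary_product_eqI[OF R, of _ I])
        (simp_all add: in_Hom_iff y' x_eq[THEN Cmp_reassoc] z_eq)
    have nat: "on_arr later h \<cdot> (nxt R \<cdot> k) = nxt (Cod C h) \<cdot> (h \<cdot> k)"
      if "h \<in> Arr C" "Dom C h = R" "k \<in> Arr C" "Cod C k = R" for h k
      using that nxt_natural[of h R "Cod C h", THEN Cmp_reassoc, of k] by simp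
    have vz: "v \<cdot> z = nxt R \<cdot> y"
      by (rule binary_product_eqI[OF LR, of _ I])
        (simp_all add: in_Hom_iff v_eq[THEN Cmp_reassoc] z_eq nat y)
    have "b \<cdot> (w \<cdot> z) = nxt X \<cdot> (ev \<cdot> y)"
      by (simp add: w_eq(2)[THEN Cmp_reassoc] vz nat)
    \<comment> \<open>Under \<open>a\<close> both sides become \<open>Id C I\<close>, because
      \<open>ev \<cdot> y\<close> is a section of \<open>p\<close>; under \<open>b\<close> both
      become \<open>nxt X \<cdot> (ev \<cdot> y)\<close>.\<close>
    then have "w \<cdot> z = n \<cdot> (ev \<cdot> y)"
      by - (rule pb_eqI[OF Lp, of _ I, folded a_def b_def]; simp add: in_Hom_iff
          w_eq(1)[THEN Cmp_reassoc] n_eq[THEN Cmp_reassoc] ev_eq[THEN Cmp_reassoc] z_eq y)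
    then show ?thesis
      by (simp add: y'_eq x_eq(3)[THEN Cmp_reassoc])
  qed
  have "\<exists>!c. c \<in> Hom C T S \<and> g \<cdot> (nxt S \<cdot> c) = c"
    by (rule fixed_point[OF T]) (simp_all add: in_Hom_iff)
  then obtain c where c: "c \<in> Hom C T S" "g \<cdot> (nxt S \<cdot> c) = c"
    and c_uniq: "\<And>c'. c' \<in> Hom C T S \<Longrightarrow> g \<cdot> (nxt S \<cdot> c') = c' \<Longrightarrow> c' = c"
    by blast
  obtain y where y: "y \<in> Arr C" "Dom C y = I" "Cod C y = R" "r \<cdot> y = c \<cdot> t" "s \<cdot> y = Id C I"
    using point[OF c(1)] by blast
  have "f \<cdot> (n \<cdot> (ev \<cdot> y)) = ev \<cdot> y"
    using key[of c y y] c y by (simp add: in_Hom_iff)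
  moreover have "h = ev \<cdot> y"
    if h: "h \<in> Hom C I X" "p \<cdot> h = Id C I" "f \<cdot> (n \<cdot> h) = h" for h
  proof -
    note ex1 = univ[OF terminal_binary_product[OF T tH] h(1,2)]
    obtain c2 y2 where c2: "c2 \<in> Hom C T S"
      and y2: "y2 \<in> Arr C" "Dom C y2 = I" "Cod C y2 = R" "r \<cdot> y2 = c2 \<cdot> t" "s \<cdot> y2 = Id C I"
      and h_eq: "ev \<cdot> y2 = h"
      using ex1_implies_ex[OF ex1] unfolding Bex_def in_Hom_iff by blast
    have c3: "g \<cdot> (nxt S \<cdot> c2) \<in> Hom C T S"
      using c2 by (simp add: in_Hom_iff)
    obtain y3 where y3: "y3 \<in> Arr C" "Dom C y3 = I" "Cod C y3 = R" "r \<cdot> y3 = (g \<cdot> (nxt S \<cdot> c2)) \<cdot> t"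
        "s \<cdot> y3 = Id C I"
      using point[OF c3] by blast
    \<comment> \<open>By \<open>key\<close> this is the fixed point equation of \<open>h\<close>. So
      \<open>c2\<close> and its image under \<open>g \<cdot> nxt S\<close> name the same section,
      and uniqueness of names makes \<open>c2\<close> a fixed point in the base.\<close>
    have "ev \<cdot> y3 = h"
      using key[of c2 y2 y3] c2 y2 y3 h h_eq by (simp add: in_Hom_iff)
    then have "\<exists>x\<in>Hom C I R. r \<cdot> x = (g \<cdot> (nxt S \<cdot> c2)) \<cdot> t \<and> s \<cdot> x = Id C I \<and> ev \<cdot> x = h"
      using y3 by (intro bexI[of _ y3]) (simp_all add: in_Hom_iff)
    moreover have "\<exists>x\<in>Hom C I R. r \<cdot> x = c2 \<cdot> t \<and> s \<cdot> x = Id C I \<and> ev \<cdot> x = h"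
      using y2 h_eq by (intro bexI[of _ y2]) (simp_all add: in_Hom_iff)
    ultimately have "g \<cdot> (nxt S \<cdot> c2) = c2"
      using ex1 c2 c3 by blast
    then have "c2 = c"
      using c2 by (intro c_uniq)
    then have "y2 = y"
      using y y2 by - (rule binary_product_eqI[OF R, of _ I]; simp add: in_Hom_iff)
    then show ?thesis
      using h_eq by simp
  qed
  moreover have "ev \<cdot> y \<in> Hom C I X" "p \<cdot> (ev \<cdot> y) = Id C I"
    using y by (simp_all add: in_Hom_iff ev_eq[THEN Cmp_reassoc])
  ultimately show ?thesis
    unfolding X by (intro ex1I[of _ "ev \<cdot> y"]) blast+
qed

section \<open>Fixed points over an arbitrary terminal object of the slice\<close>

lemma slice_fixed_point:
  assumes T: "is_terminal (slice C I) T" and p: "p \<in> Ob (slice C I)"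
    and F: "F \<in> Hom (slice C I) (on_ob (later_slice C later pb) p) p"
  shows "\<exists>!H. H \<in> Hom (slice C I) T p \<and>
    F \<cdot>\<^bsub>slice C I\<^esub> next_slice C later nxt pb p \<cdot>\<^bsub>slice C I\<^esub> H = H"
proof -
  let ?S = "slice C I" and ?a = "fst (pb (on_arr later p))"
  have p': "p \<in> Arr C" "Cod C p = I" using p by simp_all
  obtain n where n: "next_slice C later nxt pb p = (p, n, ?a)"
    "n \<in> Arr C" "Dom C n = Dom C p" "Cod C n = Dom C ?a" "?a \<cdot> n = p"
    "snd (pb (on_arr later p)) \<cdot> n = nxt (Dom C p)"
    by (rule next_slice_arr[OF p'])
  have "on_ob (later_slice C later pb) p = ?a"
    by (simp add: later_slice_def comp_func_def pullback_map_def slice_map_def)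
  with F obtain f where f: "F = (?a, f, p)" "f \<in> Arr C" "Dom C f = Dom C ?a" "Cod C f = Dom C p"
    "p \<cdot> f = ?a"
    by (auto elim!: Hom_sliceE)
  have T': "T \<in> Arr C" "Cod C T = I"
    using T by (simp_all add: is_terminal_def)
  have "Id C I \<in> Ob ?S" by simp
  \<comment> \<open>\<open>s\<close> is the inverse of \<open>T\<close> as an arrow of the base:
    \<open>T \<cdot> s\<close> is the identity since \<open>s\<close> is an arrow over
    \<open>I\<close>, and \<open>s \<cdot> T\<close> is one since both are endomorphisms of a
    terminal object.\<close>
  then obtain s where "(Id C I, s, T) \<in> Hom ?S (Id C I) T"
    using T unfolding is_terminal_def by (metis Hom_slice_shape)
  then have s: "s \<in> Arr C" "Dom C s = I" "Cod C s = Dom C T" "T \<cdot> s = Id C I"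
    by (simp_all add: in_Hom_iff)
  have sT: "s \<cdot> T = Id C (Dom C T)"
  proof -
    have "(T, s \<cdot> T, T) \<in> Hom ?S T T" "(T, Id C (Dom C T), T) \<in> Hom ?S T T"
      using s T' s(4)[THEN Cmp_reassoc, of T] by (simp_all add: in_Hom_iff)
    then show ?thesis
      using T p unfolding is_terminal_def by blast
  qed
  have "\<exists>!h. h \<in> Hom C I (Dom C p) \<and> p \<cdot> h = Id C I \<and> f \<cdot> (n \<cdot> h) = h"
    by (rule section_fixed_point[OF p' f(2-) n(2-)])
  then obtain h where h: "h \<in> Arr C" "Dom C h = I" "Cod C h = Dom C p" "p \<cdot> h = Id C I"
      "f \<cdot> (n \<cdot> h) = h"
    and uniq: "\<And>h'. h' \<in> Arr C \<Longrightarrow> Dom C h' = I \<Longrightarrow> Cod C h' = Dom C p \<Longrightarrow> p \<cdot> h' = Id C I \<Longrightarrow>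
      f \<cdot> (n \<cdot> h') = h' \<Longrightarrow> h' = h"
    unfolding in_Hom_iff by blast
  \<comment> \<open>Precomposition with \<open>T\<close> carries the fixed section to a fixed arrow
    out of \<open>T\<close>; for uniqueness, precomposition with \<open>s\<close> carries any
    solution back.\<close>
  have fnT: "f \<cdot> (n \<cdot> (h \<cdot> T)) = h \<cdot> T"
    using h n f T' Cmp_reassoc[of f "n \<cdot> h" h T] by simp
  show ?thesis
  proof (rule ex1I[of _ "(T, h \<cdot> T, p)"])
    show "(T, h \<cdot> T, p) \<in> Hom ?S T p \<and>
        F \<cdot>\<^bsub>?S\<^esub> next_slice C later nxt pb p \<cdot>\<^bsub>?S\<^esub> (T, h \<cdot> T, p) = (T, h \<cdot> T, p)"
      using fnT h T' p' h(4)[THEN Cmp_reassoc, of T] by (simp add: in_Hom_iff f(1) n(1))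
  next
    fix H assume H: "H \<in> Hom ?S T p \<and> F \<cdot>\<^bsub>?S\<^esub> next_slice C later nxt pb p \<cdot>\<^bsub>?S\<^esub> H = H"
    then obtain k where k: "H = (T, k, p)" "k \<in> Arr C" "Dom C k = Dom C T" "Cod C k = Dom C p"
      "p \<cdot> k = T"
      by (auto elim!: Hom_sliceE)
    have fnk: "f \<cdot> (n \<cdot> k) = k"
      using H by (simp add: k(1) f(1) n(1))
    have "k \<cdot> s = h"
      using k s n f p' fnk[THEN arg_cong, of "\<lambda>k. k \<cdot> s"] k(5)[THEN Cmp_reassoc, of s]
      by (intro uniq) simp_all
    then have "h \<cdot> T = k \<cdot> (s \<cdot> T)"
      using k s T' by auto
    then show "H = (T, h \<cdot> T, p)"
      using k sT by simp
  qed
qed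

lemma guarded_model_slice:
  "guarded_model (slice C I) (later_slice C later pb) (next_slice C later nxt pb)"
proof -
  have "has_finite_products (slice C I)"
    using lcc I by (simp add: locally_cartesian_closed_def cartesian_closed_def)
  then show ?thesis
    unfolding guarded_model_def
    using category_slice is_functor_later_slice later_slice_preserves_finite_limits
      next_slice_natural slice_fixed_point by blast
qed

end

theorem theorem6p3:
  fixes \<E> :: "('o, 'a) cat"
    and later :: "('o, 'a, 'o, 'a) func"
    and nxt :: "'o \<Rightarrow> 'a"
    and I :: 'o
    and pb :: "'a \<Rightarrow> 'a \<times> 'a"
  assumes "guarded_model \<E> later nxt"
    and "locally_cartesian_closed \<E>"
    and "I \<in> Ob \<E>"
    and "pullback_choice \<E> (nxt I) pb"
  shows "guarded_model (slice \<E> I) (later_slice \<E> later pb) (next_slice \<E> later nxt pb) \<and>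
         locally_cartesian_closed (slice \<E> I)"
proof -
  interpret category \<E>
    using assms(2) by (simp add: locally_cartesian_closed_def)
  interpret guarded_slice \<E> later nxt I pb
    using assms by unfold_locales
      (simp_all add: guarded_model_def is_nat_trans_def id_func_def in_Hom_iff)
  show ?thesis
    using guarded_model_slice locally_cartesian_closed_slice[OF lcc] by blast
qed

end
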